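(* Let $R$ be a local associative commutative ring with unit. Let $P$ be the maximal ideal of $R$, and assume that $P$ is generated by $\pi\in R$, where $\pi$ is not a zero divisor in $R$. Assume that the residue field of $R$ is finite and of characteristic different from $2$, and let $q=|R/P|$. Let $l$ and $m$ be integers with $l\geq 0$ and $m\geq 1$. Then $$[\mathrm{O}_{2l+1}(R):\mathrm{O}_{2l+1}^m(R)]=2\cdot[\mathrm{SO}_{2l+1}(R):\mathrm{SO}_{2l+1}^m(R)],$$ $$[\mathrm{SO}_{2l+1}(R):\mathrm{SO}_{2l+1}^m(R)]=q^{(2l^2+l)m}\prod_{i=1}^{l}\left(1-\frac{1}{q^{2i}}\right),$$ and, for $l\geq 1$, $$[\mathrm{O}_{2l}(R):\mathrm{O}_{2l}^m(R)]=2\cdot[\mathrm{SO}_{2l}(R):\mathrm{SO}_{2l}^m(R)],$$ $$[\mathrm{SO}_{2l}(R):\mathrm{SO}_{2l}^m(R)]=q^{(2l^2-l)m}\left(1-\frac{1}{q^l}\right)\prod_{i=1}^{l-1}\left(1-\frac{1}{q^{2i}}\right).$$ Here $\mathrm{O}_n^m(R)$ and $\mathrm{SO}_n^m(R)$ are the kernels of the maps $\mathrm{O}_n(R)\to\mathrm{O}_n(R/P^m)$ and $\mathrm{SO}_n(R)\to\mathrm{SO}_n(R/P^m)$ of reduction modulo $P^m$.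
   Context: For a commutative ring $A$ with unit and $n\geq 1$, let $l=\lfloor n/2\rfloor$ and $$\mathrm{O}_n(A)=\{M\in\mathrm{M}_n(A): M^{\mathrm t}SM=S\},\qquad \mathrm{SO}_n(A)=\{M\in\mathrm{O}_n(A):\det M=1\},$$ where $S=\begin{bmatrix}0&\mathrm{Id}_l\\ \mathrm{Id}_l&0\end{bmatrix}$ if $n=2l$ is even and $S=\begin{bmatrix}0&\mathrm{Id}_l&0\\ \mathrm{Id}_l&0&0\\0&0&1\end{bmatrix}$ if $n=2l+1$ is odd. *)

theory Defs
  imports
    "Jordan_Normal_Form.Determinant"
    "Jordan_Normal_Form.VS_Connect"
    "HOL-Algebra.QuotRing"
    "HOL-Algebra.Ideal_Product"
begin

text \<open>The ring \<open>A\<close> is the whole type \<open>'a\<close> of class \<^class>\<open>comm_ring_1\<close>. Ideals and quotient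
  rings are those of HOL-Algebra, applied to \<^term>\<open>class_ring\<close>, which is \<open>'a\<close> seen as a ring
  record with carrier \<^term>\<open>UNIV\<close>.\<close>

definition form_mat :: "nat \<Rightarrow> 'a::comm_ring_1 mat" where
  "form_mat n =
     (let l = n div 2;
          H = four_block_mat (0\<^sub>m l l) (1\<^sub>m l) (1\<^sub>m l) (0\<^sub>m l l)
      in if even n then H
         else four_block_mat H (0\<^sub>m (2 * l) 1) (0\<^sub>m 1 (2 * l)) (1\<^sub>m 1))"

definition orthogonal_group :: "nat \<Rightarrow> 'a::comm_ring_1 mat monoid" where
  "orthogonal_group n =
     \<lparr>carrier = {M \<in> carrier_mat n n. transpose_mat M * form_mat n * M = form_mat n},
      mult = (*), one = 1\<^sub>m n\<rparr>"

definition special_orthogonal_group :: "nat \<Rightarrow> 'a::comm_ring_1 mat monoid" where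
  "special_orthogonal_group n =
     \<lparr>carrier = {M \<in> carrier (orthogonal_group n). det M = 1},
      mult = (*), one = 1\<^sub>m n\<rparr>"

definition reduce_mat :: "'a::comm_ring_1 set \<Rightarrow> 'a mat \<Rightarrow> 'a set mat" where
  "reduce_mat I = map_mat (\<lambda>a. I +>\<^bsub>class_ring\<^esub> a)"

text \<open>The matrix multiplication of the library is not available over the record
  \<^term>\<open>class_ring Quot I\<close>. The kernel of a homomorphism depends on its codomain only through
  the unit element, which for both groups over this quotient is the following matrix.\<close>

definition quot_one_mat :: "'a::comm_ring_1 set \<Rightarrow> nat \<Rightarrow> 'a set mat" where
  "quot_one_mat I n =
     mat n n (\<lambda>(i, j). if i = j then \<one>\<^bsub>class_ring Quot I\<^esub> else \<zero>\<^bsub>class_ring Quot I\<^esub>)"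

definition orthogonal_kernel :: "nat \<Rightarrow> 'a::comm_ring_1 set \<Rightarrow> 'a mat set" where
  "orthogonal_kernel n I =
     {M \<in> carrier (orthogonal_group n). reduce_mat I M = quot_one_mat I n}"

definition special_orthogonal_kernel :: "nat \<Rightarrow> 'a::comm_ring_1 set \<Rightarrow> 'a mat set" where
  "special_orthogonal_kernel n I =
     {M \<in> carrier (special_orthogonal_group n). reduce_mat I M = quot_one_mat I n}"

text \<open>If there are infinitely many cosets, this is \<open>0\<close>.\<close>

definition group_index :: "('g, 'b) monoid_scheme \<Rightarrow> 'g set \<Rightarrow> nat" where
  "group_index G H = card (rcosets\<^bsub>G\<^esub> H)"

text \<open>The analogue for ring records of \<^const>\<open>semiring_char\<close>, which applies to types only.\<close>

definition ring_characteristic :: "('c, 'd) ring_scheme \<Rightarrow> nat" where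
  "ring_characteristic A = Gcd {n::nat. [n] \<cdot>\<^bsub>A\<^esub> \<one>\<^bsub>A\<^esub> = \<zero>\<^bsub>A\<^esub>}"

definition local_ring_with :: "('c, 'd) ring_scheme \<Rightarrow> 'c set \<Rightarrow> bool" where
  "local_ring_with A P \<longleftrightarrow>
     cring A \<and> maximalideal P A \<and> (\<forall>Q. maximalideal Q A \<longrightarrow> Q = P)"

end

theory Submission
  imports Defs "HOL-Algebra.Ring_Divisibility"
begin

text \<open>
  The index of a congruence kernel is the number of classes modulo \<open>\<pi>\<^sup>m\<close> of matrices of the group, and the
  determinant accounts for the factor \<open>2\<close>. An orthogonal matrix is a frame of columns
  \<open>u, v, w\<^sub>1, \<dots>, w\<^sub>n\<close> in which \<open>u, v\<close> span a hyperbolic plane orthogonal to the \<open>w\<^sub>i\<close>. Write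
  \<open>N = q\<^sup>m\<close>. Up to congruence, \<open>u\<close> is any primitive vector that is isotropic modulo \<open>\<pi>\<^sup>m\<close>: after an
  isometry, \<open>u = (a, b, w)\<close> with \<open>a\<close> a unit, and then \<open>b\<close> can be corrected to make \<open>u\<close> exactly isotropic,
  so that no completeness of the ring is needed. By the same isometries all fibres over \<open>u\<close> are
  in bijection with the one over \<open>e\<^sub>0 = (1, 0, 0)\<close>; moreover a frame whose first vector is congruent to
  \<open>e\<^sub>0\<close> is congruent to one that starts with \<open>e\<^sub>0\<close>. There \<open>v = (- Q w, 1, w)\<close> with \<open>N\<^sup>n\<close> choices of
  \<open>w\<close>, and the rest is a frame of length \<open>n\<close>. The primitive isotropic vectors are counted by a
  recursion in steps of \<open>2\<close> in the length.
\<close>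

section \<open>Representatives modulo a principal ideal\<close>

text \<open>The choice depends only on the class of \<open>x\<close>, so congruence modulo
  \<open>d\<close> becomes an equation between values, and \<open>range (rep d)\<close> is a
  transversal of the classes.\<close>

definition rep :: "'a::comm_ring_1 \<Rightarrow> 'a \<Rightarrow> 'a" where
  "rep d x = (SOME y. d dvd x - y)"

lemma dvd_diff_rep: "d dvd x - rep d x"
  unfolding rep_def by (rule someI[of _ x]) simp

lemma rep_eq_iff: "rep d x = rep d y \<longleftrightarrow> d dvd x - y"
proof
  assume "rep d x = rep d y"
  then have "x - y = (x - rep d x) - (y - rep d y)" by simp
  then show "d dvd x - y" using dvd_diff dvd_diff_rep by metis
next
  assume d: "d dvd x - y"
  \<comment> \<open>Congruent elements satisfy the same choice predicate, hence get the same
    representative.\<close>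
  have "d dvd x - z \<longleftrightarrow> d dvd y - z" for z
    using dvd_add_right_iff[OF d, of "y - z"] by (simp add: algebra_simps)
  then show "rep d x = rep d y" by (simp add: rep_def)
qed

lemma rep_rep [simp]: "rep d (rep d x) = rep d x"
  by (metis dvd_diff_rep dvd_minus_iff minus_diff_eq rep_eq_iff)

lemma rep_cong_add: "rep d x = rep d x' \<Longrightarrow> rep d y = rep d y' \<Longrightarrow> rep d (x + y) = rep d (x' + y')"
  unfolding rep_eq_iff by (metis add_diff_add dvd_add)

lemma rep_cong_mult:
  assumes "rep d x = rep d x'" "rep d y = rep d y'"
  shows "rep d (x * y) = rep d (x' * y')"
proof -
  have "x * y - x' * y' = x * (y - y') + (x - x') * y'" by (simp add: algebra_simps)
  with assms show ?thesis unfolding rep_eq_iff by (metis dvd_add dvd_mult dvd_mult2)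
qed

lemma rep_cong_uminus:
  assumes "rep d x = rep d x'" shows "rep d (- x) = rep d (- x')"
  using rep_cong_mult[OF refl assms, of "- 1"] by simp

lemma rep_cong_diff: "rep d x = rep d x' \<Longrightarrow> rep d y = rep d y' \<Longrightarrow> rep d (x - y) = rep d (x' - y')"
  using rep_cong_add[of d x x' "- y" "- y'"] rep_cong_uminus[of d y y'] by simp

lemmas rep_cong = rep_cong_add rep_cong_mult rep_cong_uminus rep_cong_diff

section \<open>The split symmetric form\<close>

text \<open>Vectors are lists whose coordinates are ordered as \<open>x\<^sub>1, y\<^sub>1, x\<^sub>2, y\<^sub>2, \<dots>\<close>, followed by the
  anisotropic coordinate if the length is odd, so that splitting off a hyperbolic plane is a
  recursion on lists.\<close>

fun hform :: "'a::comm_ring_1 list \<Rightarrow> 'a list \<Rightarrow> 'a" where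
  "hform (a # b # v) (c # d # w) = a * d + b * c + hform v w"
| "hform [a] [b] = a * b"
| "hform _ _ = 0"

definition axpy :: "'a::comm_ring_1 \<Rightarrow> 'a list \<Rightarrow> 'a list \<Rightarrow> 'a list" where
  "axpy a x y = map2 (\<lambda>s t. t + a * s) x y"

lemma axpy_simps [simp]:
  "axpy a [] y = []" "axpy a x [] = []" "axpy a (s # x) (t # y) = (t + a * s) # axpy a x y"
  by (simp_all add: axpy_def)

lemma length_axpy [simp]: "length (axpy a x y) = min (length x) (length y)"
  by (simp add: axpy_def)

lemma hform_commute: "hform v w = hform w v"
  by (induction v w rule: hform.induct) (simp_all add: algebra_simps)

lemma hform_axpy_left:
  "length x = length v \<Longrightarrow> length y = length v \<Longrightarrow>
    hform (axpy a x y) v = hform y v + a * hform x v"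
proof (induction y v arbitrary: x rule: hform.induct)
  case (1 b c v d e w)
  then obtain s t x' where "x = s # t # x'" by (metis length_Suc_conv)
  with 1 show ?case by (simp add: algebra_simps)
next
  case (2 b c)
  then obtain s where "x = [s]" by (metis length_Suc_conv length_0_conv)
  then show ?case by (simp add: algebra_simps)
qed auto

lemma hform_axpy_right:
  "length x = length v \<Longrightarrow> length y = length v \<Longrightarrow>
    hform v (axpy a x y) = hform v y + a * hform v x"
  using hform_axpy_left by (metis hform_commute)

lemma hform_uminus_left: "hform (map uminus v) w = - hform v w"
  by (induction v w rule: hform.induct) (simp_all add: algebra_simps)

lemma hform_uminus_right: "hform v (map uminus w) = - hform v w"
  using hform_uminus_left by (metis hform_commute)

lemma axpy_uminus:
  "length x = length y \<Longrightarrow> axpy a (map uminus x) (axpy a x y) = y"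
  "length x = length y \<Longrightarrow> axpy a x (axpy a (map uminus x) y) = y"
  by (induction x y rule: list_induct2) simp_all

lemma hform_smult_left: "hform (map ((*) a) v) w = a * hform v w"
  by (induction v w rule: hform.induct) (simp_all add: algebra_simps)

lemma hform_replicate_zero [simp]:
  "hform (replicate n 0) v = 0" "hform v (replicate n 0) = 0"
proof -
  show "hform (replicate n 0) v = 0"
    using hform_smult_left[of 0 "replicate n 0" v] by simp
  then show "hform v (replicate n 0) = 0" by (simp add: hform_commute)
qed

lemma axpy_replicate_zero [simp]: "length x = n \<Longrightarrow> axpy a x (replicate n 0) = map ((*) a) x"
  by (induction x arbitrary: n) auto

lemma map_rep_cong_hform:
  "map (rep d) v = map (rep d) v' \<Longrightarrow> map (rep d) w = map (rep d) w' \<Longrightarrow>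
    rep d (hform v w) = rep d (hform v' w')"
  by (induction v w arbitrary: v' w' rule: hform.induct)
    (auto simp: Cons_eq_map_conv map_eq_Cons_conv intro!: rep_cong)

lemma map_rep_cong_axpy:
  "rep d a = rep d a' \<Longrightarrow> map (rep d) x = map (rep d) x' \<Longrightarrow> map (rep d) y = map (rep d) y' \<Longrightarrow>
    map (rep d) (axpy a x y) = map (rep d) (axpy a' x' y')"
proof (induction x arbitrary: x' y y')
  case (Cons s x)
  then obtain s' z' where x': "x' = s' # z'" by (auto simp: Cons_eq_map_conv)
  show ?case
  proof (cases y)
    case (Cons t z)
    then obtain t' w' where "y' = t' # w'" using Cons.prems by (auto simp: Cons_eq_map_conv)
    with Cons x' Cons.prems Cons.IH[of z' z w'] show ?thesis by (auto intro!: rep_cong)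
  qed (use Cons.prems in auto)
qed auto

text \<open>The vectors of a frame are the columns of an orthogonal matrix; the Gram condition is unrolled
  along hyperbolic planes.\<close>

fun frame :: "'a::comm_ring_1 list list \<Rightarrow> bool" where
  "frame (u # v # ws) \<longleftrightarrow> hform u u = 0 \<and> hform u v = 1 \<and> hform v v = 0 \<and>
     (\<forall>w \<in> set ws. hform u w = 0 \<and> hform v w = 0) \<and> frame ws"
| "frame [u] \<longleftrightarrow> hform u u = 1"
| "frame [] \<longleftrightarrow> True"

text \<open>Only values of \<open>hform\<close> between the given vectors enter the Gram condition,
  so \<open>f\<close> may even change the length, as it does when a frame is extended by two
  coordinates.\<close>

lemma frame_map:
  "(\<And>u v. u \<in> set vs \<Longrightarrow> v \<in> set vs \<Longrightarrow> hform (f u) (f v) = hform u v) \<Longrightarrow>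
    frame (map f vs) \<longleftrightarrow> frame vs"
  by (induction vs rule: frame.induct) auto

section \<open>Local rings with principal maximal ideal\<close>

text \<open>The hypotheses on the ring in terms of elements: \<open>dvd_one\<close> and
  \<open>not_dvd_one\<close> say that the multiples of \<open>\<pi>\<close> are exactly the
  non-units, and \<open>h\<close> is the inverse of \<open>2\<close>.\<close>

locale principal_local =
  fixes \<pi> h :: "'a::comm_ring_1" and q :: nat
  assumes dvd_one: "\<not> \<pi> dvd x \<Longrightarrow> x dvd 1"
    and not_dvd_one: "\<not> \<pi> dvd 1"
    and cancel: "\<pi> * x = 0 \<Longrightarrow> x = 0"
    and half: "2 * h = 1"
    and finite_residues: "finite (range (rep \<pi>))"
    and card_residues: "card (range (rep \<pi>)) = q"
begin

text \<open>A factor that is not a multiple of \<open>\<pi>\<close> is a unit and can be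
  cancelled.\<close>

lemma dvd_mult_iff: "\<pi> dvd x * y \<longleftrightarrow> \<pi> dvd x \<or> \<pi> dvd y"
proof
  assume xy: "\<pi> dvd x * y"
  show "\<pi> dvd x \<or> \<pi> dvd y"
  proof (rule disjCI)
    assume "\<not> \<pi> dvd y"
    then obtain z where "1 = y * z" using dvd_one by (metis dvdE)
    then have "x = (x * y) * z" by (metis mult.assoc mult.right_neutral)
    with xy show "\<pi> dvd x" by (metis dvd_mult2)
  qed
qed auto

text \<open>Peels off one factor \<open>\<pi>\<close>; here it matters that \<open>\<pi>\<close> is
  not a zero divisor.\<close>

lemma dvd_Suc_iff: "\<pi> ^ Suc k dvd \<pi> * x \<longleftrightarrow> \<pi> ^ k dvd x"
proof
  assume "\<pi> ^ Suc k dvd \<pi> * x"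
  then obtain z where "\<pi> * x = \<pi> ^ Suc k * z" by (auto elim: dvdE)
  then have "\<pi> * (x - \<pi> ^ k * z) = 0" by (simp add: algebra_simps)
  then have "x = \<pi> ^ k * z" using cancel by force
  then show "\<pi> ^ k dvd x" by simp
qed (simp add: mult_dvd_mono)

definition iv :: "'a \<Rightarrow> 'a" where
  "iv x = (SOME y. x * y = 1)"

lemma iv: "\<not> \<pi> dvd x \<Longrightarrow> x * iv x = 1"
  unfolding iv_def by (rule someI_ex) (metis dvd_one dvdE)

lemma not_dvd_two: "\<not> \<pi> dvd 2"
  using half not_dvd_one by (metis dvd_mult2)

lemma half_cancel: "h * (2 * x) = x" "2 * (h * x) = x"
proof -
  have "2 * (h * x) = (2 * h) * x" "h * (2 * x) = (2 * h) * x" by (simp_all only: ac_simps)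
  then show "h * (2 * x) = x" "2 * (h * x) = x" by (simp_all add: half)
qed

text \<open>Multiplication by \<open>\<pi>\<close> is a bijection from the classes modulo
  \<open>\<pi> ^ k\<close> onto those classes modulo \<open>\<pi> ^ Suc k\<close> that consist of
  multiples of \<open>\<pi>\<close>.\<close>

lemma card_rep_multiples:
  "card (rep (\<pi> ^ Suc k) ` {x. \<pi> dvd x}) = card (range (rep (\<pi> ^ k)))"
proof -
  have "bij_betw (\<lambda>s. rep (\<pi> ^ Suc k) (\<pi> * s)) (range (rep (\<pi> ^ k)))
          (rep (\<pi> ^ Suc k) ` {x. \<pi> dvd x})"
  proof (rule bij_betw_imageI)
    have eq: "rep (\<pi> ^ Suc k) (\<pi> * s) = rep (\<pi> ^ Suc k) (\<pi> * t) \<longleftrightarrow> rep (\<pi> ^ k) s = rep (\<pi> ^ k) t"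
      for s t
      using dvd_Suc_iff[of k "s - t"] unfolding rep_eq_iff by (simp add: algebra_simps)
    show "inj_on (\<lambda>s. rep (\<pi> ^ Suc k) (\<pi> * s)) (range (rep (\<pi> ^ k)))"
      by (rule inj_onI) (metis eq rangeE rep_rep)
    have "rep (\<pi> ^ Suc k) (\<pi> * x) = rep (\<pi> ^ Suc k) (\<pi> * rep (\<pi> ^ k) x)" for x
      by (metis eq rep_rep)
    then show "(\<lambda>s. rep (\<pi> ^ Suc k) (\<pi> * s)) ` range (rep (\<pi> ^ k)) =
        rep (\<pi> ^ Suc k) ` {x. \<pi> dvd x}"
      by (auto simp: dvd_def image_iff)
  qed
  then show ?thesis by (simp add: bij_betw_same_card)
qed

text \<open>One step of the \<open>\<pi>\<close>-adic expansion: a class modulo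
  \<open>\<pi> ^ Suc k\<close> is \<open>r + \<pi> * s\<close> for a unique digit \<open>r\<close>
  modulo \<open>\<pi>\<close> and a unique class \<open>s\<close> modulo
  \<open>\<pi> ^ k\<close>.\<close>

lemma finite_card_rep: "finite (range (rep (\<pi> ^ k))) \<and> card (range (rep (\<pi> ^ k))) = q ^ k"
proof (induction k)
  case 0
  have "rep 1 x = rep 1 0" for x :: 'a by (simp add: rep_eq_iff)
  then have "range (rep (1::'a)) = {rep 1 0}" by auto
  then show ?case by simp
next
  case (Suc k)
  have "bij_betw (\<lambda>(r, s). rep (\<pi> ^ Suc k) (r + \<pi> * s)) (range (rep \<pi>) \<times> range (rep (\<pi> ^ k)))
      (range (rep (\<pi> ^ Suc k)))"
  proof (rule bij_betw_imageI)
    show "inj_on (\<lambda>(r, s). rep (\<pi> ^ Suc k) (r + \<pi> * s)) (range (rep \<pi>) \<times> range (rep (\<pi> ^ k)))"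
    proof (rule inj_onI, clarify)
      fix x y x' y'
      assume eq: "rep (\<pi> ^ Suc k) (rep \<pi> x + \<pi> * rep (\<pi> ^ k) y) =
          rep (\<pi> ^ Suc k) (rep \<pi> x' + \<pi> * rep (\<pi> ^ k) y')"
      then have "\<pi> dvd (rep \<pi> x + \<pi> * rep (\<pi> ^ k) y) - (rep \<pi> x' + \<pi> * rep (\<pi> ^ k) y')"
        unfolding rep_eq_iff by (metis dvd_trans dvd_triv_left power_Suc)
      then have "\<pi> dvd (rep \<pi> x - rep \<pi> x') + \<pi> * (rep (\<pi> ^ k) y - rep (\<pi> ^ k) y')"
        by (simp add: algebra_simps)
      then have "\<pi> dvd rep \<pi> x - rep \<pi> x'" by (simp add: dvd_add_left_iff)
      then have x: "rep \<pi> x = rep \<pi> x'" by (metis rep_eq_iff rep_rep)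
      with eq have "\<pi> ^ Suc k dvd \<pi> * (rep (\<pi> ^ k) y - rep (\<pi> ^ k) y')"
        unfolding rep_eq_iff x by (simp add: algebra_simps)
      then have "rep (\<pi> ^ k) y = rep (\<pi> ^ k) y'"
        unfolding dvd_Suc_iff by (metis rep_eq_iff rep_rep)
      with x show "rep \<pi> x = rep \<pi> x' \<and> rep (\<pi> ^ k) y = rep (\<pi> ^ k) y'" by simp
    qed
    show "(\<lambda>(r, s). rep (\<pi> ^ Suc k) (r + \<pi> * s)) ` (range (rep \<pi>) \<times> range (rep (\<pi> ^ k))) =
        range (rep (\<pi> ^ Suc k))" (is "?f ` ?S = ?R")
    proof
      show "?R \<subseteq> ?f ` ?S"
      proof
        fix y assume "y \<in> ?R"
        then obtain x where y: "y = rep (\<pi> ^ Suc k) x" by blast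
        obtain z where z: "x - rep \<pi> x = \<pi> * z" using dvd_diff_rep by (metis dvdE)
        have "x - (rep \<pi> x + \<pi> * rep (\<pi> ^ k) z) = \<pi> * (z - rep (\<pi> ^ k) z)"
          using z by (simp add: algebra_simps)
        then have "y = ?f (rep \<pi> x, rep (\<pi> ^ k) z)"
          unfolding y by (simp only: prod.case rep_eq_iff dvd_Suc_iff dvd_diff_rep)
        then show "y \<in> ?f ` ?S" by blast
      qed
    qed auto
  qed
  then have "card (range (rep \<pi>) \<times> range (rep (\<pi> ^ k))) = card (range (rep (\<pi> ^ Suc k)))"
    and "finite (range (rep (\<pi> ^ Suc k)))"
    using finite_residues Suc by (auto dest: bij_betw_same_card bij_betw_finite)
  then show ?case using Suc by (simp add: card_cartesian_product card_residues)
qed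

end

locale principal_local_level = principal_local +
  fixes m :: nat
  assumes m_pos: "m \<ge> 1"
begin

section \<open>Representatives modulo the fixed power \<open>\<pi> ^ m\<close>\<close>

abbreviation \<rho> :: "'a \<Rightarrow> 'a" where "\<rho> \<equiv> rep (\<pi> ^ m)"
definition T :: "'a set" where "T = range \<rho>"
definition TP :: "'a set" where "TP = {x \<in> T. \<pi> dvd x}"

lemma finite_T: "finite T" and card_T: "card T = q ^ m"
  using finite_card_rep by (simp_all add: T_def)

lemma finite_TP: "finite TP"
  using finite_T by (simp add: TP_def)

lemma rep_in_T [simp]: "\<rho> x \<in> T"
  by (simp add: T_def)

lemma rep_id: "x \<in> T \<Longrightarrow> \<rho> x = x"
  by (auto simp: T_def)

lemma map_rep_id: "set v \<subseteq> T \<Longrightarrow> map \<rho> v = v"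
  by (induction v) (auto simp: rep_id)

lemma set_map_rep [simp]: "set (map \<rho> v) \<subseteq> T"
  by auto

text \<open>Since \<open>m \<ge> 1\<close>, congruence modulo \<open>\<pi> ^ m\<close> refines
  congruence modulo \<open>\<pi>\<close>; hence being a unit depends only on the class.\<close>

lemma dvd_cong: "\<rho> x = \<rho> y \<Longrightarrow> \<pi> dvd x \<longleftrightarrow> \<pi> dvd y"
proof -
  assume "\<rho> x = \<rho> y"
  then have "\<pi> dvd x - y"
    unfolding rep_eq_iff using m_pos dvd_power[of m \<pi>] dvd_trans by auto
  then show ?thesis by (metis diff_add_cancel dvd_add_right_iff)
qed

lemma dvd_rep_iff [simp]: "\<pi> dvd \<rho> x \<longleftrightarrow> \<pi> dvd x"
  by (rule dvd_cong) simp

lemma card_TP: "card TP = q ^ (m - 1)"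
proof -
  have "TP = \<rho> ` {x. \<pi> dvd x}" by (auto simp: TP_def T_def)
  then show ?thesis using card_rep_multiples[of "m - 1"] m_pos finite_card_rep by simp
qed

lemma card_T_diff_TP: "card (T - TP) = q ^ m - q ^ (m - 1)"
  using finite_TP by (subst card_Diff_subset) (auto simp: TP_def card_T card_TP[unfolded TP_def])

text \<open>Half the norm, so that a hyperbolic plane contributes \<open>a * b\<close> and an
  equation \<open>Q v = c\<close> is linear in each of \<open>a\<close> and
  \<open>b\<close>.\<close>

definition Q :: "'a list \<Rightarrow> 'a" where
  "Q w = h * hform w w"

lemma Q_simps [simp]: "Q [] = 0" "Q [a] = h * (a * a)" "Q (a # b # w) = a * b + Q w"
  using half_cancel by (simp_all add: Q_def algebra_simps)

lemma hform_self: "hform w w = 2 * Q w"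
  by (simp add: Q_def half_cancel)

lemma Q_cong: "map \<rho> v = map \<rho> w \<Longrightarrow> \<rho> (Q v) = \<rho> (Q w)"
  unfolding Q_def by (intro rep_cong_mult map_rep_cong_hform refl)

lemma dvd_Q: "\<forall>x \<in> set w. \<pi> dvd x \<Longrightarrow> \<pi> dvd Q w"
proof (induction w rule: induct_list012)
  case (3 x y zs)
  then show ?case by simp
qed simp_all

section \<open>Counting primitive vectors\<close>

definition vecs :: "nat \<Rightarrow> 'a list set" where
  "vecs n = {w. set w \<subseteq> T \<and> length w = n}"

text \<open>Frames need \<open>c = 0\<close>, but a pair \<open>a, b\<close> of multiples of
  \<open>\<pi>\<close> in front of a primitive \<open>w\<close> turns \<open>c\<close> into
  \<open>c - a * b\<close>, so the recursion runs through all multiples of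
  \<open>\<pi>\<close>.\<close>

definition prim :: "nat \<Rightarrow> 'a \<Rightarrow> 'a list set" where
  "prim n c = {w \<in> vecs n. (\<exists>x \<in> set w. \<not> \<pi> dvd x) \<and> \<rho> (Q w) = \<rho> c}"

text \<open>With \<open>N = q ^ m\<close> and \<open>M = q ^ (m - 1)\<close>, there are
  \<open>N - M\<close> classes of units and \<open>M\<close> of non-units. The closed forms are
  \<open>N ^ (2 * l) - M ^ (2 * l)\<close> in length \<open>2 * l + 1\<close> and
  \<open>(N ^ Suc l - M ^ Suc l) * (N ^ l + M ^ l)\<close> in length
  \<open>2 * Suc l\<close>.\<close>

fun num_prim :: "nat \<Rightarrow> nat" where
  "num_prim 0 = 0"
| "num_prim (Suc 0) = 0"
| "num_prim (Suc (Suc n)) = (q ^ m - q ^ (m - 1)) * ((q ^ m) ^ n + (q ^ (m - 1)) ^ n) +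
     q ^ m * q ^ (m - 1) * num_prim n"

lemma finite_vecs: "finite (vecs n)" and card_vecs: "card (vecs n) = (q ^ m) ^ n"
  using finite_lists_length_eq[OF finite_T] card_lists_length_eq[OF finite_T]
  by (simp_all add: vecs_def card_T)

lemma finite_prim: "finite (prim n c)"
  using finite_vecs by (simp add: prim_def)

text \<open>A primitive \<open>w\<close> is sorted by the class of \<open>Q w\<close>, one of
  \<open>q ^ (m - 1)\<close> multiples of \<open>\<pi>\<close>, each attained \<open>k\<close>
  times. The other \<open>w\<close> have all entries in \<open>TP\<close>, and then
  \<open>Q w\<close> is a multiple of \<open>\<pi>\<close> automatically.\<close>

lemma card_dvd_Q:
  assumes "\<And>c. \<pi> dvd c \<Longrightarrow> card (prim n c) = k"
  shows "card {w \<in> vecs n. \<pi> dvd Q w} = q ^ (m - 1) * k + (q ^ (m - 1)) ^ n"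
proof -
  have "{w \<in> vecs n. \<pi> dvd Q w} =
      (\<Union>c \<in> TP. prim n c) \<union> {w. set w \<subseteq> TP \<and> length w = n}" (is "?L = ?U \<union> ?V")
  proof (intro equalityI subsetI)
    fix w assume w: "w \<in> ?L"
    show "w \<in> ?U \<union> ?V"
    proof (cases "\<forall>x \<in> set w. \<pi> dvd x")
      case True
      with w show ?thesis by (auto simp: vecs_def TP_def)
    next
      case False
      with w have "w \<in> prim n (\<rho> (Q w))" "\<rho> (Q w) \<in> TP" by (auto simp: prim_def TP_def)
      then show ?thesis by blast
    qed
  next
    fix w assume "w \<in> ?U \<union> ?V"
    then show "w \<in> ?L"
    proof
      assume "w \<in> ?U"
      then obtain c where "c \<in> TP" "w \<in> prim n c" by blast
      then show ?thesis using dvd_cong[of "Q w" c] by (simp add: prim_def TP_def)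
    next
      assume "w \<in> ?V"
      then show ?thesis using dvd_Q[of w] by (auto simp: TP_def vecs_def)
    qed
  qed
  moreover have "?U \<inter> ?V = {}" by (fastforce simp: prim_def TP_def)
  moreover have "card ?U = q ^ (m - 1) * k"
  proof -
    have "card ?U = (\<Sum>c \<in> TP. card (prim n c))"
      using finite_TP finite_prim
      by (intro card_UN_disjoint) (auto simp: prim_def TP_def dest: rep_id, metis rep_id)
    also have "\<dots> = (\<Sum>c \<in> TP. k)" by (intro sum.cong refl assms) (simp add: TP_def)
    finally show ?thesis by (simp add: card_TP)
  qed
  ultimately show ?thesis
    using finite_TP finite_prim
    by (simp add: card_Un_disjoint finite_lists_length_eq card_lists_length_eq card_TP)
qed

text \<open>A primitive vector \<open>a # b # w\<close> has \<open>a\<close> a unit, or \<open>b\<close> but not \<open>a\<close> a unit, or \<open>w\<close> primitive. In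
  the first two cases the equation \<open>Q (a # b # w) = c\<close> determines \<open>b\<close>, respectively \<open>a\<close>.\<close>

lemma card_prim: "\<pi> dvd c \<Longrightarrow> card (prim n c) = num_prim n"
proof (induction n arbitrary: c rule: num_prim.induct)
  case (1 c)
  then show ?case by (simp add: prim_def vecs_def)
next
  case (2 c)
  \<comment> \<open>A single coordinate is never primitive here: \<open>\<pi>\<close> divides
    \<open>2 * (h * (x * x)) = x * x\<close>, hence \<open>x\<close>.\<close>
  have "\<pi> dvd x" if "\<rho> (h * (x * x)) = \<rho> c" for x
  proof -
    have "\<pi> dvd 2 * (h * (x * x))" using dvd_cong[OF that] 2 by simp
    then show ?thesis by (simp add: half_cancel dvd_mult_iff)
  qed
  then have "prim (Suc 0) c = {}" by (auto simp: prim_def vecs_def length_Suc_conv)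
  then show ?case by simp
next
  case (3 n c)
  let ?U = "T - TP"
  let ?f = "\<lambda>(a, w). a # \<rho> ((c - Q w) * iv a) # w"
  let ?g = "\<lambda>(b, w). \<rho> ((c - Q w) * iv b) # b # w"
  let ?k = "\<lambda>((a, b), w). a # b # w"
  let ?A = "?f ` (?U \<times> vecs n)"
  \<comment> \<open>The condition \<open>\<pi> dvd Q w\<close> makes the solved first entry a
    multiple of \<open>\<pi>\<close>, which keeps \<open>?B\<close> disjoint from \<open>?A\<close>.
    It is forced, because \<open>a\<close> and \<open>c\<close> are multiples of
    \<open>\<pi>\<close>.\<close>
  let ?B = "?g ` (?U \<times> {w \<in> vecs n. \<pi> dvd Q w})"
  let ?C = "?k ` (SIGMA ab : TP \<times> TP. prim n (c - fst ab * snd ab))"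
  have solve: "\<rho> (a * \<rho> ((c - Q w) * iv a) + Q w) = \<rho> c" if "\<not> \<pi> dvd a" for a w
  proof -
    have "\<rho> (a * \<rho> ((c - Q w) * iv a) + Q w) = \<rho> (a * ((c - Q w) * iv a) + Q w)"
      by (intro rep_cong) simp_all
    also have "a * ((c - Q w) * iv a) = (a * iv a) * (c - Q w)" by (simp only: ac_simps)
    also have "\<dots> + Q w = c" using iv[OF that] by simp
    finally show ?thesis .
  qed
  have solved: "b = \<rho> ((c - Q w) * iv a)" if "\<rho> (a * b + Q w) = \<rho> c" "b \<in> T" "\<not> \<pi> dvd a" for a b w
  proof -
    have "\<rho> ((c - Q w) * iv a) = \<rho> ((a * b + Q w - Q w) * iv a)"
      using that(1) by (intro rep_cong) simp_all
    also have "(a * b + Q w - Q w) * iv a = (a * iv a) * b" by (simp add: ac_simps)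
    also have "\<dots> = b" using iv[OF that(3)] by simp
    finally show ?thesis using that(2) by (simp add: rep_id)
  qed
  have U: "a \<in> ?U \<longleftrightarrow> a \<in> T \<and> \<not> \<pi> dvd a" for a by (auto simp: TP_def)
  have "prim (Suc (Suc n)) c = (?A \<union> ?B) \<union> ?C"
  proof (intro equalityI subsetI)
    fix v assume v: "v \<in> prim (Suc (Suc n)) c"
    then obtain a b w where v_eq: "v = a # b # w" and ab: "a \<in> T" "b \<in> T" "w \<in> vecs n"
      by (auto simp: prim_def vecs_def length_Suc_conv)
    have eq: "\<rho> (a * b + Q w) = \<rho> c" "\<rho> (b * a + Q w) = \<rho> c"
      using v v_eq by (auto simp: prim_def mult.commute)
    consider "\<not> \<pi> dvd a" | "\<pi> dvd a" "\<not> \<pi> dvd b" | "\<pi> dvd a" "\<pi> dvd b" by blast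
    then show "v \<in> (?A \<union> ?B) \<union> ?C"
    proof cases
      case 1
      then have "v = ?f (a, w)" using solved[OF eq(1)] ab v_eq by simp
      then show ?thesis using 1 ab U by blast
    next
      case 2
      have "\<pi> dvd a * b + Q w" using dvd_cong[OF eq(1)] 3 by simp
      then have "\<pi> dvd Q w" using 2 dvd_add_right_iff by (metis dvd_mult2)
      moreover have "v = ?g (b, w)" using 2 solved[OF eq(2)] ab v_eq by simp
      ultimately show ?thesis using 2 ab U by blast
    next
      case 3
      have "\<rho> (Q w) = \<rho> (a * b + Q w - a * b)" by simp
      also have "\<dots> = \<rho> (c - a * b)" using eq by (intro rep_cong) simp_all
      finally have "w \<in> prim n (c - a * b)"
        using 3 v v_eq ab by (auto simp: prim_def)
      then have "((a, b), w) \<in> (SIGMA ab : TP \<times> TP. prim n (c - fst ab * snd ab))"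
        using 3 ab by (simp add: TP_def)
      then have "?k ((a, b), w) \<in> ?C" by (rule imageI)
      then show ?thesis using v_eq by simp
    qed
  next
    fix v assume "v \<in> (?A \<union> ?B) \<union> ?C"
    then consider "v \<in> ?A" | "v \<in> ?B" | "v \<in> ?C" by blast
    then show "v \<in> prim (Suc (Suc n)) c"
    proof cases
      case 1
      then obtain a w where v: "v = ?f (a, w)" "a \<in> ?U" "w \<in> vecs n" by blast
      moreover from this have "a \<in> T" "\<not> \<pi> dvd a" using U by blast+
      ultimately show ?thesis using solve[of a w] by (simp add: prim_def vecs_def)
    next
      case 2
      then obtain b w where v: "v = ?g (b, w)" "b \<in> ?U" "w \<in> vecs n" by blast
      moreover from this have "b \<in> T" "\<not> \<pi> dvd b" using U by blast+
      ultimately show ?thesis using solve[of b w] by (simp add: prim_def vecs_def mult.commute)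
    next
      case 3
      then obtain a b w where v: "v = a # b # w" "a \<in> TP" "b \<in> TP" "w \<in> prim n (c - a * b)"
        by auto
      have "\<rho> (a * b + Q w) = \<rho> (a * b + (c - a * b))"
        using v by (intro rep_cong) (simp_all add: prim_def)
      then show ?thesis using v by (auto simp: prim_def vecs_def TP_def)
    qed
  qed
  moreover have "?A \<inter> ?B = {}"
  proof -
    have "\<not> \<pi> dvd hd v" if "v \<in> ?A" for v using that by (auto simp: TP_def)
    moreover have "\<pi> dvd hd v" if "v \<in> ?B" for v
      using that "3.prems" by (auto intro!: dvd_mult2 dvd_diff)
    ultimately show ?thesis by blast
  qed
  moreover have "(?A \<union> ?B) \<inter> ?C = {}"
    by (auto simp: TP_def)
  moreover have "card ?A = (q ^ m - q ^ (m - 1)) * (q ^ m) ^ n"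
    by (subst card_image) (auto simp: inj_on_def card_cartesian_product card_T_diff_TP card_vecs)
  moreover have "card ?B = (q ^ m - q ^ (m - 1)) * (q ^ (m - 1) * num_prim n + (q ^ (m - 1)) ^ n)"
    using card_dvd_Q[OF 3(1)]
    by (subst card_image) (auto simp: inj_on_def card_cartesian_product card_T_diff_TP)
  moreover have "card ?C = q ^ (m - 1) * q ^ (m - 1) * num_prim n"
  proof -
    have "card ?C = card (SIGMA ab : TP \<times> TP. prim n (c - fst ab * snd ab))"
      by (rule card_image) (auto simp: inj_on_def)
    also have "\<dots> = (\<Sum>ab \<in> TP \<times> TP. card (prim n (c - fst ab * snd ab)))"
      using finite_TP finite_prim by (intro card_SigmaI) auto
    also have "\<dots> = (\<Sum>ab \<in> TP \<times> TP. num_prim n)"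
      using 3 by (intro sum.cong refl 3(1)) (auto simp: TP_def intro!: dvd_diff dvd_mult)
    finally show ?thesis by (simp add: card_cartesian_product card_TP)
  qed
  moreover have "finite ?A" "finite ?B" "finite ?C"
    using finite_T finite_TP finite_vecs finite_prim by auto
  ultimately have "card (prim (Suc (Suc n)) c) =
      (q ^ m - q ^ (m - 1)) * (q ^ m) ^ n +
      (q ^ m - q ^ (m - 1)) * (q ^ (m - 1) * num_prim n + (q ^ (m - 1)) ^ n) +
      q ^ (m - 1) * q ^ (m - 1) * num_prim n"
    by (simp add: card_Un_disjoint)
  also have "\<dots> = num_prim (Suc (Suc n))"
  proof -
    \<comment> \<open>Writing \<open>q ^ m = q ^ (m - 1) + d\<close> removes the truncated
      subtraction, and \<open>d + q ^ (m - 1)\<close> then merges the two terms with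
      \<open>num_prim n\<close>.\<close>
    have "card TP \<le> card T" using finite_T by (intro card_mono) (auto simp: TP_def)
    then have "q ^ (m - 1) \<le> q ^ m" by (simp add: card_T card_TP)
    then obtain d where "q ^ m = q ^ (m - 1) + d" using le_Suc_ex by blast
    then show ?thesis by (simp add: algebra_simps)
  qed
  finally show ?case .
qed

end

context principal_local_level
begin

section \<open>Isometries\<close>

text \<open>One half of being an isometry, separated so that a map and its inverse are treated by
  one argument. Respecting congruence lets \<open>f\<close> act on classes.\<close>

definition isometric_section :: "nat \<Rightarrow> ('a list \<Rightarrow> 'a list) \<Rightarrow> ('a list \<Rightarrow> 'a list) \<Rightarrow> bool" where
  "isometric_section n f g \<longleftrightarrow>
     (\<forall>v. length v = n \<longrightarrow> length (f v) = n \<and> g (f v) = v) \<and>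
     (\<forall>v w. length v = n \<longrightarrow> length w = n \<longrightarrow> hform (f v) (f w) = hform v w \<and>
        (map \<rho> v = map \<rho> w \<longrightarrow> map \<rho> (f v) = map \<rho> (f w)))"

definition isometry :: "nat \<Rightarrow> ('a list \<Rightarrow> 'a list) \<Rightarrow> ('a list \<Rightarrow> 'a list) \<Rightarrow> bool" where
  "isometry n f g \<longleftrightarrow> isometric_section n f g \<and> isometric_section n g f"

lemma isometry_sym: "isometry n f g \<Longrightarrow> isometry n g f"
  by (simp add: isometry_def)

lemma isometryD:
  assumes "isometry n f g" "length v = n"
  shows "length (f v) = n" "g (f v) = v"
    "length w = n \<Longrightarrow> hform (f v) (f w) = hform v w"
    "length w = n \<Longrightarrow> map \<rho> v = map \<rho> w \<Longrightarrow> map \<rho> (f v) = map \<rho> (f w)"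
  using assms unfolding isometry_def isometric_section_def by blast+

lemma isometry_comp:
  assumes fg: "isometry n f g" and fg': "isometry n f' g'"
  shows "isometry n (f \<circ> f') (g' \<circ> g)"
proof -
  have "isometric_section n (f \<circ> f') (g' \<circ> g)" if "isometry n f g" "isometry n f' g'" for f g f' g'
    unfolding isometric_section_def comp_def
    using isometryD[OF that(1)] isometryD[OF that(2)] by metis
  from this[OF fg fg'] this[OF isometry_sym[OF fg'] isometry_sym[OF fg]] show ?thesis
    by (simp add: isometry_def)
qed

lemma isometry_id: "isometry n id id"
  by (simp add: isometry_def isometric_section_def)

fun scale :: "'a \<Rightarrow> 'a \<Rightarrow> 'a list \<Rightarrow> 'a list" where
  "scale a b (s # t # x) = a * s # b * t # x"
| "scale a b x = x"

fun swap :: "'a list \<Rightarrow> 'a list" where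
  "swap (s # t # x) = t # s # x"
| "swap x = x"

text \<open>The Eichler transformation of \<open>w\<close>: it fixes the first coordinate vector and
  sends the second to \<open>- Q w # 1 # w\<close>.\<close>

fun shear :: "'a list \<Rightarrow> 'a list \<Rightarrow> 'a list" where
  "shear w (s # t # x) = (s - hform w x - Q w * t) # t # axpy t w x"
| "shear w x = x"

lemma isometry_scale:
  assumes "a * b = 1" shows "isometry (Suc (Suc n)) (scale a b) (scale b a)"
proof -
  have "isometric_section (Suc (Suc n)) (scale a b) (scale b a)" if ab: "a * b = 1" for a b
  proof -
    have cancel: "b * (a * s) = s" "a * (b * s) = s" for s
      using ab by (metis mult.commute mult.left_commute mult.right_neutral)+
    have "a * s * (b * t) = s * t" for s t
    proof -
      have "a * s * (b * t) = (a * b) * (s * t)" by (simp only: ac_simps)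
      then show ?thesis by (simp add: ab)
    qed
    moreover from this have "b * t * (a * s) = t * s" for s t by (metis mult.commute)
    ultimately show ?thesis
      by (auto simp: isometric_section_def length_Suc_conv cancel intro!: rep_cong)
  qed
  from this[of a b] this[of b a] show ?thesis
    using assms by (simp add: isometry_def mult.commute)
qed

lemma isometry_swap: "isometry (Suc (Suc n)) swap swap"
  by (auto simp: isometry_def isometric_section_def length_Suc_conv)

lemma Q_uminus: "Q (map uminus w) = Q w"
  by (simp add: Q_def hform_uminus_left hform_uminus_right)

lemma Q_replicate_zero [simp]: "Q (replicate n 0) = 0"
  by (simp add: Q_def)

lemma isometry_shear:
  assumes "length w = n" shows "isometry (Suc (Suc n)) (shear w) (shear (map uminus w))"
proof -
  have "isometric_section (Suc (Suc n)) (shear w) (shear (map uminus w))" if w: "length w = n" for w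
    unfolding isometric_section_def
  proof (intro conjI allI impI)
    fix v :: "'a list" assume "length v = Suc (Suc n)"
    then obtain s t x where v: "v = s # t # x" "length x = n" by (auto simp: length_Suc_conv)
    with w show "length (shear w v) = Suc (Suc n)" by simp
    show "shear (map uminus w) (shear w v) = v"
      using v w by (simp add: axpy_uminus hform_uminus_left hform_axpy_right hform_self Q_uminus)
    fix v' :: "'a list" assume "length v' = Suc (Suc n)"
    then obtain s' t' x' where v': "v' = s' # t' # x'" "length x' = n" by (auto simp: length_Suc_conv)
    show "hform (shear w v) (shear w v') = hform v v'"
      using v v' w
      by (simp add: hform_axpy_left hform_axpy_right hform_self hform_commute[of x w])
        (simp add: algebra_simps)
    assume "map \<rho> v = map \<rho> v'"
    then show "map \<rho> (shear w v) = map \<rho> (shear w v')"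
      using v v' by (auto intro!: rep_cong map_rep_cong_hform map_rep_cong_axpy)
  qed
  from this[of w] this[of "map uminus w"] show ?thesis
    using assms by (simp add: isometry_def comp_def)
qed

text \<open>Nondegeneracy modulo \<open>\<pi>\<close>: \<open>x\<close> is the coordinate vector
  paired with a unit entry of \<open>w\<close>.\<close>

lemma exists_hform_unit:
  "\<exists>y \<in> set w. \<not> \<pi> dvd y \<Longrightarrow> \<exists>x. length x = length w \<and> \<not> \<pi> dvd hform x w"
proof (induction w rule: induct_list012)
  case (2 a)
  then have "length [1] = length [a] \<and> \<not> \<pi> dvd hform [1] [a]" by simp
  then show ?case by blast
next
  case (3 a b w)
  consider "\<not> \<pi> dvd a" | "\<not> \<pi> dvd b" | "\<exists>y \<in> set w. \<not> \<pi> dvd y" using 3 by auto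
  then show ?case
  proof cases
    case 1
    then show ?thesis by (intro exI[of _ "0 # 1 # replicate (length w) 0"]) simp
  next
    case 2
    then show ?thesis by (intro exI[of _ "1 # 0 # replicate (length w) 0"]) simp
  next
    case 3
    then obtain x where "length x = length w" "\<not> \<pi> dvd hform x w" using "3.IH" by blast
    then show ?thesis by (intro exI[of _ "0 # 0 # x"]) simp
  qed
qed simp

text \<open>If the second entry is a unit, swap. If neither of the first two is, a shear adds the
  unit \<open>- hform x w\<close> to the first entry and otherwise changes it only by a multiple of
  \<open>\<pi>\<close>.\<close>

lemma exists_isometry_unit_head:
  assumes "length v = Suc (Suc n)" "\<exists>y \<in> set v. \<not> \<pi> dvd y"
  shows "\<exists>f g. isometry (Suc (Suc n)) f g \<and> \<not> \<pi> dvd hd (f v)"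
proof -
  from assms(1) obtain a b w where v: "v = a # b # w" "length w = n" by (auto simp: length_Suc_conv)
  consider "\<not> \<pi> dvd a" | "\<not> \<pi> dvd b" | "\<pi> dvd a" "\<pi> dvd b" "\<exists>y \<in> set w. \<not> \<pi> dvd y"
    using v assms(2) by auto
  then show ?thesis
  proof cases
    case 1
    then show ?thesis using isometry_id v by fastforce
  next
    case 2
    then show ?thesis using isometry_swap v by fastforce
  next
    case 3
    then obtain x where x: "length x = n" "\<not> \<pi> dvd hform x w" using exists_hform_unit v by blast
    have "\<not> \<pi> dvd a - hform x w - Q x * b"
    proof
      assume "\<pi> dvd a - hform x w - Q x * b"
      then have "\<pi> dvd a - Q x * b - (a - hform x w - Q x * b)"
        by (rule dvd_diff[OF dvd_diff[OF 3(1) dvd_mult[OF 3(2)]]])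
      also have "a - Q x * b - (a - hform x w - Q x * b) = hform x w" by simp
      finally show False using x by simp
    qed
    then show ?thesis using isometry_shear[OF x(1)] v by fastforce
  qed
qed

abbreviation e0 :: "nat \<Rightarrow> 'a list" where
  "e0 n \<equiv> 1 # 0 # replicate n 0"

text \<open>An isometry that sends \<open>e0\<close> to \<open>a # b # w\<close>, with \<open>b\<close> determined by \<open>a * b + Q w = 0\<close>.\<close>

definition lift :: "'a \<Rightarrow> 'a list \<Rightarrow> 'a list \<Rightarrow> 'a list" where
  "lift a w = scale a (iv a) \<circ> (swap \<circ> (shear w \<circ> swap))"

lemma exists_isometry_lift:
  assumes "\<not> \<pi> dvd a" "length w = n"
  shows "\<exists>g. isometry (Suc (Suc n)) (lift a w) g"
  unfolding lift_def
  using isometry_comp[OF isometry_scale[OF iv[OF assms(1)]]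
      isometry_comp[OF isometry_swap isometry_comp[OF isometry_shear[OF assms(2)] isometry_swap]]]
  by blast

lemma lift_simp: "lift a w (s # t # x) = a * s # iv a * (t - hform w x - Q w * s) # axpy s w x"
  by (simp add: lift_def)

lemma lift_e0: "length w = n \<Longrightarrow> lift a w (e0 n) = a # - (iv a * Q w) # w"
  by (simp add: lift_simp map_idI)

text \<open>Takes the place of Hensel's lemma: with \<open>a\<close> a unit the isotropy equation is
  linear in \<open>b\<close>, so \<open>f v\<close> is congruent to the exactly isotropic
  \<open>lift a w (e0 n)\<close>, and the inverse isometry carries this back.\<close>

lemma exists_isometry_prim:
  assumes "v \<in> prim (Suc (Suc n)) 0"
  shows "\<exists>f g. isometry (Suc (Suc n)) f g \<and> map \<rho> (f (e0 n)) = v"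
proof -
  let ?n = "Suc (Suc n)"
  have v: "length v = ?n" "\<rho> (Q v) = \<rho> 0" "set v \<subseteq> T"
    using assms by (auto simp: prim_def vecs_def)
  obtain f g where fg: "isometry ?n f g" "\<not> \<pi> dvd hd (f v)"
    using exists_isometry_unit_head[of v n] assms v(1) by (auto simp: prim_def)
  obtain a b w where fv: "f v = a # b # w" "length w = n"
    using isometryD(1)[OF fg(1) v(1)] by (auto simp: length_Suc_conv)
  have a: "\<not> \<pi> dvd a" using fg fv by simp
  have "Q (f v) = Q v" using isometryD(3)[OF fg(1) v(1) v(1)] by (simp add: Q_def)
  then have eq: "\<rho> (a * b + Q w) = \<rho> 0" using v fv by simp
  have b: "b = iv a * (a * b + Q w) - iv a * Q w"
  proof -
    have "iv a * (a * b + Q w) - iv a * Q w = (a * iv a) * b" by (simp add: algebra_simps)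
    then show ?thesis using iv[OF a] by simp
  qed
  have "\<rho> b = \<rho> (iv a * 0 - iv a * Q w)"
    by (subst b, intro rep_cong eq refl)
  then have "map \<rho> (f v) = map \<rho> (lift a w (e0 n))"
    using fv by (simp add: lift_e0)
  moreover obtain g' where g': "isometry ?n (lift a w) g'" using exists_isometry_lift[OF a fv(2)] by blast
  moreover have "length (e0 n) = ?n" by simp
  ultimately have "map \<rho> (g (lift a w (e0 n))) = map \<rho> (g (f v))"
    using isometryD(4)[OF isometry_sym[OF fg(1)]] isometryD(1)[OF g'] isometryD(1)[OF fg(1) v(1)]
    by metis
  also have "\<dots> = v" using isometryD(2)[OF fg(1) v(1)] v map_rep_id by simp
  finally have "map \<rho> ((g \<circ> lift a w) (e0 n)) = v" by simp
  then show ?thesis using isometry_comp[OF isometry_sym[OF fg(1)] g'] by blast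
qed

text \<open>Exact isotropy forces the second entry of \<open>u\<close>, so \<open>lift a w\<close>
  sends \<open>e0 n\<close> to \<open>u\<close> itself; its parameters \<open>a\<close> and
  \<open>w\<close> are congruent to \<open>1\<close> and zero, which makes it congruent to the
  identity.\<close>

lemma exists_isometry_cong_id:
  assumes "length u = Suc (Suc n)" "map \<rho> u = map \<rho> (e0 n)" "hform u u = 0"
  shows "\<exists>f g. isometry (Suc (Suc n)) f g \<and> f (e0 n) = u \<and>
    (\<forall>v. length v = Suc (Suc n) \<longrightarrow> map \<rho> (f v) = map \<rho> v)"
proof -
  from assms(1) obtain a b w where u: "u = a # b # w" "length w = n" by (auto simp: length_Suc_conv)
  with assms(2) have cong: "\<rho> a = \<rho> 1" "map \<rho> w = map \<rho> (replicate n 0)" by simp_all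
  have a: "\<not> \<pi> dvd a" using dvd_cong[OF cong(1)] not_dvd_one by simp
  have "Q u = 0" using assms(3) by (simp add: Q_def)
  then have Qw: "Q w = - (a * b)" using u by (simp add: eq_neg_iff_add_eq_0 add.commute)
  have "iv a * Q w = - ((a * iv a) * b)" unfolding Qw by (simp add: algebra_simps)
  then have eq: "lift a w (e0 n) = u" using u lift_e0 iv[OF a] by simp
  have iv_cong: "\<rho> (iv a) = \<rho> 1"
  proof -
    have "\<rho> (1 * iv a) = \<rho> (a * iv a)" by (intro rep_cong cong(1)[symmetric] refl)
    then show ?thesis using iv[OF a] by simp
  qed
  have "map \<rho> (lift a w v) = map \<rho> v" if "length v = Suc (Suc n)" for v
  proof -
    from that obtain s t x where v: "v = s # t # x" "length x = n" by (auto simp: length_Suc_conv)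
    let ?z = "replicate n 0 :: 'a list"
    \<comment> \<open>The right-hand side is the formula for \<open>lift\<close> with
      \<open>a\<close>, \<open>iv a\<close> and \<open>w\<close> replaced by the congruent
      \<open>1\<close>, \<open>1\<close> and \<open>?z\<close>.\<close>
    have "map \<rho> (lift a w v) = map \<rho> (1 * s # 1 * (t - hform ?z x - Q ?z * s) # axpy s ?z x)"
      unfolding v lift_simp list.map list.inject
      by (intro conjI rep_cong map_rep_cong_hform map_rep_cong_axpy Q_cong cong iv_cong refl)
    also have "axpy s ?z x = x" using v(2) by (induction x arbitrary: n) auto
    finally show ?thesis using v by (simp add: Q_def)
  qed
  then show ?thesis using eq exists_isometry_lift[OF a u(2)] by blast
qed

section \<open>Counting frames\<close>

definition frames :: "nat \<Rightarrow> 'a list list set" where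
  "frames n = {vs. length vs = n \<and> (\<forall>v \<in> set vs. length v = n) \<and> frame vs}"

definition frame_classes :: "nat \<Rightarrow> 'a list list set" where
  "frame_classes n = map (map \<rho>) ` frames n"

lemma finite_frame_classes: "finite (frame_classes n)"
proof (rule finite_subset)
  show "frame_classes n \<subseteq> {C. set C \<subseteq> vecs n \<and> length C = n}"
    by (auto simp: frame_classes_def frames_def vecs_def)
  show "finite {C. set C \<subseteq> vecs n \<and> length C = n}"
    using finite_vecs by (rule finite_lists_length_eq)
qed

lemma frames_map:
  assumes "isometry n f g" "vs \<in> frames n" shows "map f vs \<in> frames n"
  using assms isometryD[OF assms(1)] frame_map[of vs f] by (auto simp: frames_def)

text \<open>The reduced vectors in \<open>C\<close> need not form an exact frame, so
  \<open>f\<close> is followed by reduction; compatibility with congruence identifies the result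
  with the class of \<open>map f vs\<close>.\<close>

lemma frame_classes_map:
  assumes fg: "isometry n f g" and C: "C \<in> frame_classes n"
  shows "map (map \<rho> \<circ> f) C \<in> frame_classes n" "map (map \<rho> \<circ> g) (map (map \<rho> \<circ> f) C) = C"
proof -
  obtain vs where vs: "vs \<in> frames n" "C = map (map \<rho>) vs" using C by (auto simp: frame_classes_def)
  then have len: "\<forall>v \<in> set vs. length v = n" by (simp add: frames_def)
  have f: "map \<rho> (f (map \<rho> v)) = map \<rho> (f v)" if "length v = n" for v
    by (rule isometryD(4)[OF fg]) (simp_all add: that)
  have g: "map \<rho> (g (map \<rho> v)) = map \<rho> (g v)" if "length v = n" for v
    by (rule isometryD(4)[OF isometry_sym[OF fg]]) (simp_all add: that)
  have C': "map (map \<rho> \<circ> f) C = map (map \<rho>) (map f vs)" using vs f len by simp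
  then show "map (map \<rho> \<circ> f) C \<in> frame_classes n"
    using frames_map[OF fg vs(1)] unfolding frame_classes_def by (metis imageI)
  show "map (map \<rho> \<circ> g) (map (map \<rho> \<circ> f) C) = C"
    unfolding C' using vs g len isometryD[OF fg] by simp
qed

text \<open>Applying \<open>f\<close> to classes is a bijection between the two fibres, inverted by
  \<open>g\<close>.\<close>

lemma card_fibre_eq:
  assumes fg: "isometry n f g" and u: "length u = n" and n: "n > 0"
  shows "card {C \<in> frame_classes n. hd C = map \<rho> (f u)} = card {C \<in> frame_classes n. hd C = map \<rho> u}"
proof -
  have hd: "hd (map (map \<rho> \<circ> f') C) = map \<rho> (f' w)"
    if "isometry n f' g'" "C \<in> frame_classes n" "hd C = map \<rho> w" "length w = n" for f' g' C w
  proof -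
    have "C \<noteq> []" using that(2) n by (auto simp: frame_classes_def frames_def)
    then have "hd (map (map \<rho> \<circ> f') C) = map \<rho> (f' (map \<rho> w))" using that(3) by (simp add: hd_map)
    also have "\<dots> = map \<rho> (f' w)" by (rule isometryD(4)[OF that(1)]) (simp_all add: that(4))
    finally show ?thesis .
  qed
  note gf = isometry_sym[OF fg]
  have "bij_betw (map (map \<rho> \<circ> f)) {C \<in> frame_classes n. hd C = map \<rho> u}
      {C \<in> frame_classes n. hd C = map \<rho> (f u)}"
  proof (rule bij_betw_byWitness[where f' = "map (map \<rho> \<circ> g)"])
    show "map (map \<rho> \<circ> f) ` {C \<in> frame_classes n. hd C = map \<rho> u} \<subseteq>
        {C \<in> frame_classes n. hd C = map \<rho> (f u)}"
      using frame_classes_map(1)[OF fg] hd[OF fg _ _ u] by blast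
    show "map (map \<rho> \<circ> g) ` {C \<in> frame_classes n. hd C = map \<rho> (f u)} \<subseteq>
        {C \<in> frame_classes n. hd C = map \<rho> u}"
      using frame_classes_map(1)[OF gf] hd[OF gf _ _ isometryD(1)[OF fg u]] isometryD(2)[OF fg u]
      by auto
  qed (use frame_classes_map(2)[OF fg] frame_classes_map(2)[OF gf] in blast)+
  then show ?thesis by (simp add: bij_betw_same_card)
qed

text \<open>The frames of length \<open>n + 2\<close> that start with \<open>e0\<close>: the second vector is determined by its last
  \<open>n\<close> coordinates \<open>w\<close>, and the remaining ones by a frame of length \<open>n\<close> and orthogonality.\<close>

definition extend_frame :: "nat \<Rightarrow> 'a list \<Rightarrow> 'a list list \<Rightarrow> 'a list list" where
  "extend_frame n w vs = e0 n # (- Q w # 1 # w) # map (\<lambda>v. - hform w v # 0 # v) vs"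

text \<open>The vectors after the first two have second entry \<open>0\<close> and so pair like
  their tails; the leading entries \<open>- Q w\<close> and \<open>- hform w v\<close> supply
  isotropy and orthogonality.\<close>

lemma frame_extend_iff: "frame (extend_frame n w vs) \<longleftrightarrow> frame vs"
proof -
  have "frame (map (\<lambda>v. - hform w v # 0 # v) vs) \<longleftrightarrow> frame vs" by (rule frame_map) simp
  then show ?thesis by (simp add: extend_frame_def hform_self)
qed

text \<open>Pairing with \<open>e0 n\<close> reads off the second entry, which is therefore
  \<open>1\<close> for the second vector and \<open>0\<close> for the later ones; isotropy and
  orthogonality to the second vector then determine the first entries.\<close>

lemma frame_e0_imp_extend:
  assumes "frame us" "us \<in> frames (Suc (Suc n))" "hd us = e0 n"
  shows "\<exists>w vs. us = extend_frame n w vs \<and> length w = n \<and> vs \<in> frames n"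
proof -
  obtain u d es where "us = u # d # es"
    using assms(2) by (auto simp: frames_def length_Suc_conv)
  with assms(3) have us: "us = e0 n # d # es" by simp
  then obtain a b w where d: "d = a # b # w" "length w = n"
    using assms by (auto simp: frames_def length_Suc_conv)
  have b: "b = 1" using assms us d by simp
  have "hform d d = 0" using assms(1) us by simp
  then have "Q d = 0" by (simp add: Q_def)
  then have "a + Q w = 0" using d b by simp
  then have a: "a = - Q w" by (simp add: half_cancel eq_neg_iff_add_eq_0)
  have e: "e = - hform w (drop 2 e) # 0 # drop 2 e \<and> length (drop 2 e) = n" if "e \<in> set es" for e
  proof -
    have "length e = Suc (Suc n)" using assms(2) us that by (simp add: frames_def)
    then obtain s t c where e: "e = s # t # c" "length c = n" by (auto simp: length_Suc_conv)
    have "hform (e0 n) e = 0" "hform d e = 0" using assms us that by auto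
    then show ?thesis using e d b by (simp add: eq_neg_iff_add_eq_0)
  qed
  define vs where "vs = map (drop 2) es"
  have "es = map (\<lambda>v. - hform w v # 0 # v) vs"
    unfolding vs_def map_map by (rule map_idI[symmetric]) (use e in simp)
  then have eq: "us = extend_frame n w vs" using us d a b by (simp add: extend_frame_def)
  moreover have "frame vs" using assms(1) eq frame_extend_iff by simp
  then have "vs \<in> frames n"
    using assms(2) us e by (auto simp: frames_def vs_def)
  ultimately show ?thesis using d by blast
qed

lemma map_rep_extend_cong:
  assumes "map \<rho> w = map \<rho> w'" "map (map \<rho>) vs = map (map \<rho>) vs'"
  shows "map (map \<rho>) (extend_frame n w vs) = map (map \<rho>) (extend_frame n w' vs')"
proof -
  have "map (map \<rho>) (map (\<lambda>v. - hform w v # 0 # v) vs) = map (map \<rho>) (map (\<lambda>v. - hform w' v # 0 # v) vs')"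
    using assms(2)
  proof (induction vs arbitrary: vs')
    case (Cons v vs)
    then obtain v' vs'' where "vs' = v' # vs''" by (auto simp: Cons_eq_map_conv)
    then show ?case
      using Cons assms(1) by (auto intro!: rep_cong map_rep_cong_hform)
  qed simp
  then show ?thesis
    using assms(1) by (auto simp: extend_frame_def intro!: rep_cong Q_cong)
qed

text \<open>Surjectivity: an isometry congruent to the identity moves a frame whose first vector is
  congruent to \<open>e0 n\<close> to one of the same class that starts with \<open>e0 n\<close>
  itself. Injectivity: \<open>w\<close> and \<open>C\<close> are read off from the last
  \<open>n\<close> coordinates.\<close>

lemma card_fibre_e0:
  "card {C \<in> frame_classes (Suc (Suc n)). hd C = map \<rho> (e0 n)} = (q ^ m) ^ n * card (frame_classes n)"
proof -
  let ?n = "Suc (Suc n)"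
  let ?f = "\<lambda>(w, C). map (map \<rho>) (extend_frame n w C)"
  have "{C \<in> frame_classes ?n. hd C = map \<rho> (e0 n)} = ?f ` (vecs n \<times> frame_classes n)"
  proof (intro equalityI subsetI)
    fix C assume "C \<in> {C \<in> frame_classes ?n. hd C = map \<rho> (e0 n)}"
    then obtain us where us: "us \<in> frames ?n" "C = map (map \<rho>) us" "hd C = map \<rho> (e0 n)"
      by (auto simp: frame_classes_def)
    have ne: "us \<noteq> []" using us by (auto simp: frames_def)
    then obtain u us' where u: "us = u # us'" by (cases us) auto
    have len: "\<forall>v \<in> set us. length v = ?n" using us by (simp add: frames_def)
    have "length u = ?n" "map \<rho> u = map \<rho> (e0 n)" "hform u u = 0"
      using us u by (auto simp: frames_def length_Suc_conv)
    then obtain f g where fg: "isometry ?n f g" "f (e0 n) = u"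
        "\<And>v. length v = ?n \<Longrightarrow> map \<rho> (f v) = map \<rho> v"
      using exists_isometry_cong_id by blast
    note gf = isometry_sym[OF fg(1)]
    have g: "map \<rho> (g v) = map \<rho> v" if "length v = ?n" for v
      using fg(3)[of "g v"] isometryD(1,2)[OF gf that] by simp
    have "map g us \<in> frames ?n" using frames_map[OF gf us(1)] .
    moreover have "hd (map g us) = e0 n"
      using u fg(2) isometryD(2)[OF fg(1), of "e0 n"] by simp
    ultimately obtain w vs where wvs: "map g us = extend_frame n w vs" "length w = n" "vs \<in> frames n"
      using frame_e0_imp_extend[of "map g us" n] by (auto simp: frames_def)
    have "C = map (map \<rho>) (map g us)" using us g len by simp
    also have "\<dots> = map (map \<rho>) (extend_frame n (map \<rho> w) (map (map \<rho>) vs))"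
      unfolding wvs by (rule map_rep_extend_cong) (simp_all add: comp_def)
    finally have "C = ?f (map \<rho> w, map (map \<rho>) vs)" by simp
    moreover have "(map \<rho> w, map (map \<rho>) vs) \<in> vecs n \<times> frame_classes n"
      using wvs by (auto simp: vecs_def frame_classes_def)
    ultimately show "C \<in> ?f ` (vecs n \<times> frame_classes n)" by blast
  next
    fix C assume "C \<in> ?f ` (vecs n \<times> frame_classes n)"
    then obtain w vs where C: "C = ?f (w, map (map \<rho>) vs)" "w \<in> vecs n" "vs \<in> frames n"
      by (auto simp: frame_classes_def)
    have "C = map (map \<rho>) (extend_frame n w vs)"
      unfolding C(1) prod.case by (rule map_rep_extend_cong) (simp_all add: comp_def)
    moreover have "extend_frame n w vs \<in> frames ?n"
      using C frame_extend_iff by (auto simp: frames_def vecs_def) (auto simp: extend_frame_def)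
    ultimately show "C \<in> {C \<in> frame_classes ?n. hd C = map \<rho> (e0 n)}"
      by (auto simp: frame_classes_def) (simp add: extend_frame_def)
  qed
  moreover have "inj_on ?f (vecs n \<times> frame_classes n)"
  proof (rule inj_onI, clarify)
    fix w C w' C'
    assume w: "w \<in> vecs n" "w' \<in> vecs n" and C: "C \<in> frame_classes n" "C' \<in> frame_classes n"
      and eq: "map (map \<rho>) (extend_frame n w C) = map (map \<rho>) (extend_frame n w' C')"
    have "map \<rho> w = map \<rho> w'" using eq by (simp add: extend_frame_def)
    then have "w = w'" using w by (simp add: vecs_def map_rep_id)
    moreover have "map (map \<rho>) C = map (map \<rho>) C'"
    proof -
      have "map (\<lambda>v. drop 2 (map \<rho> v)) (drop 2 (extend_frame n w C)) =
          map (\<lambda>v. drop 2 (map \<rho> v)) (drop 2 (extend_frame n w' C'))"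
        using arg_cong[OF eq, of "\<lambda>x. map (drop 2) (drop 2 x)"] by (simp add: drop_map comp_def)
      then show ?thesis by (simp add: extend_frame_def comp_def)
    qed
    then have "C = C'" using C by (auto simp: frame_classes_def comp_def)
    ultimately show "w = w' \<and> C = C'" by simp
  qed
  ultimately show ?thesis by (simp add: card_image card_cartesian_product card_vecs)
qed

text \<open>The classes are fibred over their first vector, which runs through
  \<open>prim (Suc (Suc n)) 0\<close>; isometries make every fibre as large as the one over
  \<open>e0 n\<close>.\<close>

lemma card_frame_classes_Suc_Suc:
  "card (frame_classes (Suc (Suc n))) = num_prim (Suc (Suc n)) * (q ^ m) ^ n * card (frame_classes n)"
proof -
  let ?n = "Suc (Suc n)"
  let ?F = "\<lambda>u. {C \<in> frame_classes ?n. hd C = u}"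
  have "frame_classes ?n = (\<Union>u \<in> prim ?n 0. ?F u)"
  proof -
    have "hd C \<in> prim ?n 0" if C: "C \<in> frame_classes ?n" for C
    proof -
      obtain vs where vs: "vs \<in> frames ?n" "C = map (map \<rho>) vs"
        using C by (auto simp: frame_classes_def)
      then obtain u v us where "vs = u # v # us"
        by (auto simp: frames_def length_Suc_conv)
      with vs have us: "u # v # us \<in> frames ?n" "C = map (map \<rho>) (u # v # us)" by simp_all
      have uv: "hform u u = 0" "hform u v = 1" "length u = ?n" using us by (auto simp: frames_def)
      \<comment> \<open>If every entry of \<open>u\<close> were a multiple of \<open>\<pi>\<close>,
        so would be \<open>hform u v = 1\<close>.\<close>
      have "\<exists>x \<in> set u. \<not> \<pi> dvd x"
      proof (rule ccontr)
        assume "\<not> ?thesis"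
        then have "\<pi> dvd hform u v"
          by (induction u v rule: hform.induct) simp_all
        then show False using uv not_dvd_one by simp
      qed
      moreover have "\<rho> (Q (map \<rho> u)) = \<rho> (Q u)" by (rule Q_cong) simp
      ultimately show ?thesis using us uv by (auto simp: prim_def vecs_def Q_def)
    qed
    then show ?thesis by auto
  qed
  then have "card (frame_classes ?n) = card (\<Union>u \<in> prim ?n 0. ?F u)" by simp
  also have "\<dots> = (\<Sum>u \<in> prim ?n 0. card (?F u))"
    using finite_prim finite_frame_classes by (intro card_UN_disjoint) auto
  also have "\<dots> = (\<Sum>u \<in> prim ?n 0. (q ^ m) ^ n * card (frame_classes n))"
  proof (rule sum.cong[OF refl])
    fix u assume "u \<in> prim ?n 0"
    then obtain f g where "isometry ?n f g" "map \<rho> (f (e0 n)) = u"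
      using exists_isometry_prim by blast
    then show "card (?F u) = (q ^ m) ^ n * card (frame_classes n)"
      using card_fibre_eq[of ?n f g "e0 n"] card_fibre_e0 by simp
  qed
  also have "\<dots> = num_prim ?n * (q ^ m) ^ n * card (frame_classes n)"
    by (simp add: card_prim del: num_prim.simps)
  finally show ?thesis .
qed

section \<open>Frames of length 0 and 1\<close>

lemma card_frame_classes_0: "card (frame_classes 0) = 1"
proof -
  have "frames 0 = {[]}" by (auto simp: frames_def)
  then show ?thesis by (simp add: frame_classes_def)
qed

text \<open>\<open>x - 1\<close> and \<open>x + 1\<close> differ by the unit \<open>2\<close>, so
  they are not both multiples of \<open>\<pi>\<close>; one of them is a unit and is
  cancelled.\<close>

lemma square_eq_one:
  assumes "x * x = 1" shows "x = 1 \<or> x = (- 1 :: 'a)"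
proof -
  from assms have prod: "(x + 1) * (x - 1) = 0" by (simp add: algebra_simps)
  show ?thesis
  proof (cases "\<pi> dvd x - 1")
    case True
    have "\<not> \<pi> dvd x + 1"
    proof
      assume "\<pi> dvd x + 1"
      then have "\<pi> dvd (x + 1) - (x - 1)" using True by (rule dvd_diff)
      then show False using not_dvd_two by simp
    qed
    have "x - 1 = ((x + 1) * iv (x + 1)) * (x - 1)" using iv \<open>\<not> \<pi> dvd x + 1\<close> by simp
    also have "\<dots> = iv (x + 1) * ((x + 1) * (x - 1))" by (simp only: ac_simps)
    finally show ?thesis using prod by simp
  next
    case False
    have "x + 1 = (x + 1) * ((x - 1) * iv (x - 1))" using iv False by simp
    also have "\<dots> = iv (x - 1) * ((x + 1) * (x - 1))" by (simp only: ac_simps)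
    finally show ?thesis using prod by (simp add: eq_neg_iff_add_eq_0)
  qed
qed

lemma rep_one_neq: "\<rho> 1 \<noteq> \<rho> (- 1)"
proof
  assume "\<rho> 1 = \<rho> (- 1)"
  then have "\<rho> (1 - (- 1)) = \<rho> (- 1 - (- 1))" by (intro rep_cong refl)
  then show False using dvd_cong[of 2 0] not_dvd_two by simp
qed

lemma card_frame_classes_1: "card (frame_classes (Suc 0)) = 2"
proof -
  have "frames (Suc 0) = {[[1]], [[- 1]]}"
    by (auto simp: frames_def length_Suc_conv dest!: square_eq_one)
  then show ?thesis using rep_one_neq by (simp add: frame_classes_def)
qed

end

section \<open>Orthogonal matrices and frames\<close>

text \<open>The pairing of coordinates under \<open>hform\<close> on lists of length
  \<open>n\<close>.\<close>

fun flip :: "nat \<Rightarrow> nat \<Rightarrow> nat" where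
  "flip (Suc (Suc n)) 0 = 1"
| "flip (Suc (Suc n)) (Suc 0) = 0"
| "flip (Suc (Suc n)) (Suc (Suc k)) = Suc (Suc (flip n k))"
| "flip _ k = k"

lemma flip_less: "k < n \<Longrightarrow> flip n k < n"
  by (induction n k rule: flip.induct) auto

lemma flip_eq: "flip n k = (if k < 2 * (n div 2) then if even k then Suc k else k - 1 else k)"
  by (induction n k rule: flip.induct) auto

lemma hform_eq_sum:
  "length v = length w \<Longrightarrow> hform v w = (\<Sum>k<length v. v ! k * w ! flip (length v) k)"
  by (induction v w rule: hform.induct) (simp_all add: sum.lessThan_Suc_shift del: sum.lessThan_Suc)

text \<open>\<open>frame\<close> tests each pair of vectors in one order only; the opposite order
  follows from the symmetry of \<open>hform\<close>.\<close>

lemma frame_iff: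
  "frame vs \<longleftrightarrow> (\<forall>i<length vs. \<forall>j<length vs.
     hform (vs ! i) (vs ! j) = (if j = flip (length vs) i then 1 else 0))"
proof (induction vs rule: frame.induct)
  case (1 u v ws)
  have "hform (ws ! i) u = hform u (ws ! i)" "hform (ws ! i) v = hform v (ws ! i)" for i
    by (rule hform_commute)+
  with 1 hform_commute[of v u] show ?case
    by (simp add: All_less_Suc2 all_set_conv_all_nth all_conj_distrib imp_conjR) auto
qed (simp_all add: All_less_Suc2)

text \<open>The counterpart of \<open>flip\<close> in the coordinate order of
  \<open>form_mat\<close>: with \<open>l = n div 2\<close>, the only \<open>1\<close> in row
  \<open>i\<close> stands in column \<open>partner l i\<close>.\<close>

definition partner :: "nat \<Rightarrow> nat \<Rightarrow> nat" where
  "partner l i = (if i < l then i + l else if i < 2 * l then i - l else i)"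

text \<open>Position \<open>k\<close> of the list ordering \<open>x\<^sub>1, y\<^sub>1, x\<^sub>2, y\<^sub>2, \<dots>\<close> is index \<open>place l k\<close> of the ordering
  \<open>x\<^sub>1, x\<^sub>2, \<dots>, y\<^sub>1, y\<^sub>2, \<dots>\<close> used by \<^const>\<open>form_mat\<close>.\<close>

definition place :: "nat \<Rightarrow> nat \<Rightarrow> nat" where
  "place l k = (if k < 2 * l then if even k then k div 2 else l + k div 2 else k)"

lemma partner_less: "i < n \<Longrightarrow> partner (n div 2) i < n"
  by (auto simp: partner_def)

lemma partner_partner [simp]: "partner l (partner l i) = i"
  by (auto simp: partner_def)

text \<open>\<open>place\<close> intertwines the two pairings, so that renumbering by it turns
  \<open>hform\<close> into the form of \<open>form_mat\<close>.\<close>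

lemma partner_place: "partner (n div 2) (place (n div 2) k) = place (n div 2) (flip n k)"
proof (cases "k < 2 * (n div 2)")
  case True
  show ?thesis
  proof (cases "even k")
    case True
    then obtain i where "k = 2 * i" by (rule evenE)
    with \<open>k < 2 * (n div 2)\<close> show ?thesis by (simp add: flip_eq partner_def place_def)
  next
    case False
    then obtain i where "k = 2 * i + 1" by (rule oddE)
    with \<open>k < 2 * (n div 2)\<close> show ?thesis by (simp add: flip_eq partner_def place_def)
  qed
qed (simp add: flip_eq partner_def place_def)

lemma bij_betw_place: "bij_betw (place (n div 2)) {..<n} {..<n}"
proof (rule bij_betw_byWitness)
  let ?l = "n div 2"
  let ?g = "\<lambda>i. if i < ?l then 2 * i else if i < 2 * ?l then 2 * (i - ?l) + 1 else i"
  show "\<forall>k \<in> {..<n}. ?g (place ?l k) = k"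
    by (auto simp: place_def elim!: evenE oddE)
  show "\<forall>i \<in> {..<n}. place ?l (?g i) = i"
    by (auto simp: place_def)
  show "place ?l ` {..<n} \<subseteq> {..<n}" by (auto simp: place_def)
  show "?g ` {..<n} \<subseteq> {..<n}" by auto
qed

lemma place_less: "k < n \<Longrightarrow> place (n div 2) k < n"
  using bij_betw_place[of n] by (auto simp: bij_betw_def)

section \<open>Entries of the form matrix and the Gram condition\<close>

lemma dim_form_mat [simp]: "dim_row (form_mat n) = n" "dim_col (form_mat n) = n"
  by (auto simp: form_mat_def Let_def elim!: evenE oddE)

lemma form_mat_carrier [simp]: "form_mat n \<in> carrier_mat n n"
  by (rule carrier_matI) simp_all

lemma form_mat_index:
  assumes "i < n" "j < n"
  shows "form_mat n $$ (i, j) = (if j = partner (n div 2) i then 1 else 0 :: 'a::comm_ring_1)"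
proof (cases "even n")
  case True
  then obtain l where "n = 2 * l" by (rule evenE)
  with assms show ?thesis by (auto simp: form_mat_def Let_def partner_def)
next
  case False
  then obtain l where "n = 2 * l + 1" by (rule oddE)
  with assms show ?thesis by (auto simp: form_mat_def Let_def partner_def)
qed

lemma mult_mat_index:
  assumes "A \<in> carrier_mat n n" "B \<in> carrier_mat n n" "i < n" "j < n"
  shows "(A * B) $$ (i, j) = (\<Sum>k<n. A $$ (i, k) * B $$ (k, j))"
  using assms by (simp add: scalar_prod_def lessThan_atLeast0)

lemma form_mat_mult_index:
  assumes "M \<in> carrier_mat n n" "i < n" "j < n"
  shows "(form_mat n * M) $$ (i, j) = M $$ (partner (n div 2) i, j)"
proof -
  have "(form_mat n * M) $$ (i, j) = (\<Sum>k<n. form_mat n $$ (i, k) * M $$ (k, j))"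
    using assms by (intro mult_mat_index) simp_all
  also have "\<dots> = (\<Sum>k<n. if k = partner (n div 2) i then M $$ (k, j) else 0)"
    using assms by (intro sum.cong) (auto simp: form_mat_index)
  finally show ?thesis using assms partner_less[of i n] by simp
qed

lemma transpose_form_mult_index:
  assumes "M \<in> carrier_mat n n" "i < n" "j < n"
  shows "(transpose_mat M * form_mat n * M) $$ (i, j) =
    (\<Sum>k<n. M $$ (k, i) * M $$ (partner (n div 2) k, j))"
proof -
  have "transpose_mat M * form_mat n * M = transpose_mat M * (form_mat n * M)"
    using assms by (intro assoc_mult_mat) auto
  also have "\<dots> $$ (i, j) = (\<Sum>k<n. transpose_mat M $$ (i, k) * (form_mat n * M) $$ (k, j))"
    using assms by (intro mult_mat_index) auto
  also have "\<dots> = (\<Sum>k<n. M $$ (k, i) * M $$ (partner (n div 2) k, j))"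
    using assms by (intro sum.cong) (simp_all add: form_mat_mult_index del: index_mult_mat(1))
  finally show ?thesis .
qed

lemma orthogonal_iff:
  assumes "M \<in> carrier_mat n n"
  shows "M \<in> carrier (orthogonal_group n) \<longleftrightarrow>
    (\<forall>i<n. \<forall>j<n. (\<Sum>k<n. M $$ (k, i) * M $$ (partner (n div 2) k, j)) =
      (if j = partner (n div 2) i then 1 else 0))"
proof -
  have "transpose_mat M * form_mat n * M = form_mat n \<longleftrightarrow>
      (\<forall>i<n. \<forall>j<n. (transpose_mat M * form_mat n * M) $$ (i, j) = form_mat n $$ (i, j))"
    using assms by (auto simp: mat_eq_iff)
  then show ?thesis
    using assms
    by (simp add: orthogonal_group_def transpose_form_mult_index form_mat_index del: index_mult_mat(1))
qed

text \<open>Renumbering the rows adapts the entries to \<open>hform\<close>; renumbering the columns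
  adapts the order of the vectors to \<open>frame\<close>.\<close>

definition columns :: "nat \<Rightarrow> 'a mat \<Rightarrow> 'a list list" where
  "columns n M = map (\<lambda>j. map (\<lambda>i. M $$ (place (n div 2) i, place (n div 2) j)) [0..<n]) [0..<n]"

lemma length_columns [simp]: "length (columns n M) = n"
  by (simp add: columns_def)

lemma hform_columns:
  assumes "i < n" "j < n"
  shows "hform (columns n M ! i) (columns n M ! j) =
    (\<Sum>k<n. M $$ (k, place (n div 2) i) * M $$ (partner (n div 2) k, place (n div 2) j))"
proof -
  let ?p = "place (n div 2)"
  have "hform (columns n M ! i) (columns n M ! j) =
      (\<Sum>k<n. M $$ (?p k, ?p i) * M $$ (?p (flip n k), ?p j))"
    using assms by (auto simp: columns_def hform_eq_sum flip_less intro!: sum.cong)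
  also have "\<dots> = (\<Sum>k<n. M $$ (?p k, ?p i) * M $$ (partner (n div 2) (?p k), ?p j))"
    by (simp add: partner_place)
  also have "\<dots> = (\<Sum>k<n. M $$ (k, ?p i) * M $$ (partner (n div 2) k, ?p j))"
    by (rule sum.reindex_bij_betw[OF bij_betw_place])
  finally show ?thesis .
qed

lemma ball_place_iff: "(\<forall>i<n. P (place (n div 2) i)) \<longleftrightarrow> (\<forall>i<n. P i)"
proof -
  have "place (n div 2) ` {..<n} = {..<n}" using bij_betw_place by (auto simp: bij_betw_def)
  then show ?thesis by (metis imageE imageI lessThan_iff)
qed

lemma ball2_place_iff:
  "(\<forall>i<n. \<forall>j<n. P (place (n div 2) i) (place (n div 2) j)) \<longleftrightarrow> (\<forall>i<n. \<forall>j<n. P i j)"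
  using ball_place_iff[of n "\<lambda>i. \<forall>j<n. P i (place (n div 2) j)"] ball_place_iff[of n "P i" for i]
  by simp

lemma orthogonal_iff_frame:
  assumes "M \<in> carrier_mat n n"
  shows "M \<in> carrier (orthogonal_group n) \<longleftrightarrow> frame (columns n M)"
proof -
  let ?p = "place (n div 2)"
  have inj: "?p j = ?p (flip n i) \<longleftrightarrow> j = flip n i" if "i < n" "j < n" for i j
    using that bij_betw_place[of n] flip_less[of i n]
    by (auto simp: bij_betw_def dest: inj_onD)
  have "M \<in> carrier (orthogonal_group n) \<longleftrightarrow>
    (\<forall>i<n. \<forall>j<n. (\<Sum>k<n. M $$ (k, ?p i) * M $$ (partner (n div 2) k, ?p j)) =
      (if ?p j = partner (n div 2) (?p i) then 1 else 0))"
    unfolding orthogonal_iff[OF assms]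
    by (rule ball2_place_iff[symmetric])
  also have "\<dots> \<longleftrightarrow> frame (columns n M)"
    unfolding frame_iff using inj by (simp add: hform_columns partner_place)
  finally show ?thesis .
qed

text \<open>Sending \<open>f x\<close> to \<open>g x\<close> is well defined and injective because
  \<open>f\<close> and \<open>g\<close> have the same fibres on \<open>A\<close>. Classes can thus
  be counted in any encoding.\<close>

lemma card_image_eq_if_kernel_eq:
  assumes "\<And>x y. x \<in> A \<Longrightarrow> y \<in> A \<Longrightarrow> f x = f y \<longleftrightarrow> g x = g y"
  shows "card (f ` A) = card (g ` A)" "finite (f ` A) \<longleftrightarrow> finite (g ` A)"
proof -
  have "bij_betw (\<lambda>y. g (inv_into A f y)) (f ` A) (g ` A)"
  proof (rule bij_betw_imageI)
    have inv: "g (inv_into A f (f x)) = g x" if "x \<in> A" for x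
      using that assms[of "inv_into A f (f x)" x] by (simp add: f_inv_into_f inv_into_into)
    then show "inj_on (\<lambda>y. g (inv_into A f y)) (f ` A)"
      using assms by (auto simp: inj_on_def)
    show "(\<lambda>y. g (inv_into A f y)) ` f ` A = g ` A"
      using inv by (auto simp: image_image)
  qed
  then show "card (f ` A) = card (g ` A)" "finite (f ` A) \<longleftrightarrow> finite (g ` A)"
    by (rule bij_betw_same_card, rule bij_betw_finite)
qed

context principal_local_level
begin

lemma columns_mem_frames: "M \<in> carrier (orthogonal_group n) \<Longrightarrow> columns n M \<in> frames n"
  using orthogonal_iff_frame[of M n] by (auto simp: frames_def orthogonal_group_def) (auto simp: columns_def)

lemma frames_subset_columns: "frames n \<subseteq> columns n ` carrier (orthogonal_group n)"
proof
  fix vs assume vs: "vs \<in> frames n"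
  let ?p = "place (n div 2)"
  let ?s = "inv_into {..<n} ?p"
  \<comment> \<open>\<open>?s\<close> inverts \<open>place\<close>, so that \<open>columns\<close>
    recovers \<open>vs\<close>.\<close>
  define M where "M = mat n n (\<lambda>(i, j). vs ! ?s j ! ?s i)"
  have M: "M \<in> carrier_mat n n" by (simp add: M_def)
  have s: "?s (?p k) = k" if "k < n" for k
    using that bij_betw_place[of n] by (simp add: bij_betw_def inv_into_f_f)
  have "columns n M = map (\<lambda>j. map (\<lambda>i. vs ! j ! i) [0..<n]) [0..<n]"
    by (simp add: columns_def M_def place_less s)
  also have "\<dots> = vs"
    using vs by (intro nth_equalityI) (auto simp: frames_def intro!: nth_equalityI)
  finally have "columns n M = vs" .
  moreover from this have "M \<in> carrier (orthogonal_group n)"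
    using orthogonal_iff_frame[OF M] vs by (simp add: frames_def)
  ultimately show "vs \<in> columns n ` carrier (orthogonal_group n)" by blast
qed

lemma map_rep_columns_eq_iff:
  assumes "M \<in> carrier_mat n n" "M' \<in> carrier_mat n n"
  shows "map (map \<rho>) (columns n M) = map (map \<rho>) (columns n M') \<longleftrightarrow> map_mat \<rho> M = map_mat \<rho> M'"
proof -
  let ?p = "place (n div 2)"
  have "map (map \<rho>) (columns n M) = map (map \<rho>) (columns n M') \<longleftrightarrow>
      (\<forall>j<n. \<forall>i<n. \<rho> (M $$ (?p i, ?p j)) = \<rho> (M' $$ (?p i, ?p j)))"
    by (auto simp: columns_def)
  also have "\<dots> \<longleftrightarrow> (\<forall>j<n. \<forall>i<n. \<rho> (M $$ (i, j)) = \<rho> (M' $$ (i, j)))"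
    by (rule ball2_place_iff)
  also have "\<dots> \<longleftrightarrow> map_mat \<rho> M = map_mat \<rho> M'"
    using assms by (auto simp: mat_eq_iff)
  finally show ?thesis .
qed

lemma card_orthogonal_classes:
    "card (map_mat \<rho> ` carrier (orthogonal_group n)) = card (frame_classes n)"
  and finite_orthogonal_classes: "finite (map_mat \<rho> ` carrier (orthogonal_group n))"
proof -
  have frames: "frames n = columns n ` carrier (orthogonal_group n)"
    using columns_mem_frames frames_subset_columns by blast
  have eq: "map_mat \<rho> M = map_mat \<rho> M' \<longleftrightarrow>
      map (map \<rho>) (columns n M) = map (map \<rho>) (columns n M')"
    if "M \<in> carrier (orthogonal_group n)" "M' \<in> carrier (orthogonal_group n)" for M M'
    using that map_rep_columns_eq_iff[of M n M'] by (simp add: orthogonal_group_def)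
  show "card (map_mat \<rho> ` carrier (orthogonal_group n)) = card (frame_classes n)"
    using card_image_eq_if_kernel_eq(1)[OF eq]
    by (simp add: frame_classes_def frames image_image)
  show "finite (map_mat \<rho> ` carrier (orthogonal_group n))"
    using card_image_eq_if_kernel_eq(2)[of "carrier (orthogonal_group n)"
        "map_mat \<rho>" "\<lambda>M. map (map \<rho>) (columns n M)", OF eq] finite_frame_classes[of n]
    by (simp add: frame_classes_def frames image_image)
qed

end

section \<open>The orthogonal groups and their indices\<close>

lemma form_mat_square: "form_mat n * form_mat n = (1\<^sub>m n :: 'a::comm_ring_1 mat)"
  by (rule eq_matI) (auto simp: form_mat_mult_index form_mat_index partner_less simp del: index_mult_mat(1))

text \<open>After taking determinants in the defining equation, \<open>det (form_mat n)\<close> is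
  cancelled: \<open>form_mat n\<close> is its own inverse, so its determinant has square
  \<open>1\<close>.\<close>

lemma det_orthogonal_square:
  fixes M :: "'a::comm_ring_1 mat"
  assumes "M \<in> carrier (orthogonal_group n)" shows "det M * det M = 1"
proof -
  let ?S = "form_mat n :: 'a mat"
  have M: "M \<in> carrier_mat n n" "transpose_mat M * ?S * M = ?S"
    using assms by (simp_all add: orthogonal_group_def)
  have "det (transpose_mat M * ?S * M) = det M * det ?S * det M"
    using M(1) by (simp add: det_mult[of _ n] det_transpose)
  then have *: "det M * det ?S * det M = det ?S" using M(2) by simp
  have S: "det ?S * det ?S = 1"
    using det_mult[of ?S n ?S] by (simp add: form_mat_square)
  have "det M * det M = (det M * det ?S * det M) * det ?S"
    using S by (simp add: ac_simps)
  then show ?thesis using * S by simp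
qed

lemma group_orthogonal_group: "group (orthogonal_group n :: 'a::comm_ring_1 mat monoid)"
proof (rule groupI)
  let ?S = "form_mat n :: 'a mat" and ?G = "orthogonal_group n :: 'a mat monoid"
  have one: "1\<^sub>m n \<in> carrier ?G" by (simp add: orthogonal_group_def)
  then show "\<one>\<^bsub>?G\<^esub> \<in> carrier ?G" by (simp add: orthogonal_group_def)
  fix A assume A: "A \<in> carrier ?G"
  then have Ac: "A \<in> carrier_mat n n" and Ao: "transpose_mat A * ?S * A = ?S"
    by (simp_all add: orthogonal_group_def)
  show "\<one>\<^bsub>?G\<^esub> \<otimes>\<^bsub>?G\<^esub> A = A" using Ac by (simp add: orthogonal_group_def)
  have mult: "A * B \<in> carrier ?G" if "A \<in> carrier ?G" "B \<in> carrier ?G" for A B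
  proof -
    have c: "A \<in> carrier_mat n n" "B \<in> carrier_mat n n"
      and o: "transpose_mat A * ?S * A = ?S" "transpose_mat B * ?S * B = ?S"
      using that by (simp_all add: orthogonal_group_def)
    have "transpose_mat (A * B) * ?S * (A * B) = transpose_mat B * (transpose_mat A * ?S * A) * B"
      using c by (simp add: transpose_mult[of _ n n _ n] assoc_mult_mat[of _ n n _ n _ n] mult_carrier_mat[of _ n n])
    then show ?thesis using c o by (simp add: orthogonal_group_def)
  qed
  fix B assume B: "B \<in> carrier ?G"
  show "A \<otimes>\<^bsub>?G\<^esub> B \<in> carrier ?G" using mult[OF A B] by (simp add: orthogonal_group_def)
  fix C assume "C \<in> carrier ?G"
  then show "A \<otimes>\<^bsub>?G\<^esub> B \<otimes>\<^bsub>?G\<^esub> C = A \<otimes>\<^bsub>?G\<^esub> (B \<otimes>\<^bsub>?G\<^esub> C)"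
    using A B by (auto simp: orthogonal_group_def intro!: assoc_mult_mat)
next
  let ?S = "form_mat n :: 'a mat" and ?G = "orthogonal_group n :: 'a mat monoid"
  fix A assume A: "A \<in> carrier ?G"
  then have Ac: "A \<in> carrier_mat n n" and Ao: "transpose_mat A * ?S * A = ?S"
    by (simp_all add: orthogonal_group_def)
  \<comment> \<open>A left inverse of \<open>A\<close>: multiply the defining equation by the
    involution \<open>?S\<close>.\<close>
  define B where "B = ?S * transpose_mat A * ?S"
  have Bc: "B \<in> carrier_mat n n" using Ac by (auto simp: B_def)
  have BA: "B * A = 1\<^sub>m n"
  proof -
    have "B * A = ?S * (transpose_mat A * ?S * A)"
      using Ac by (simp add: B_def assoc_mult_mat[of _ n n _ n _ n] mult_carrier_mat[of _ n n])
    then show ?thesis by (simp add: Ao form_mat_square)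
  qed
  have AB: "A * B = 1\<^sub>m n"
  proof -
    \<comment> \<open>A right inverse from the adjugate, since \<open>det A\<close> has square
      \<open>1\<close>; it must agree with the left inverse \<open>B\<close>.\<close>
    define C where "C = det A \<cdot>\<^sub>m adj_mat A"
    have C: "C \<in> carrier_mat n n" using adj_mat(1)[OF Ac] by (simp add: C_def)
    have AC: "A * C = 1\<^sub>m n"
    proof -
      have "A * C = det A \<cdot>\<^sub>m (det A \<cdot>\<^sub>m 1\<^sub>m n)"
        using adj_mat(1,2)[OF Ac] Ac by (simp add: C_def mult_smult_distrib)
      also have "\<dots> = 1\<^sub>m n"
        using det_orthogonal_square[OF A] by (intro eq_matI) (auto simp: mult.assoc[symmetric])
      finally show ?thesis .
    qed
    have "B = B * (A * C)" using AC Bc by simp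
    also have "\<dots> = (B * A) * C" using Ac Bc C by (intro assoc_mult_mat[symmetric]) auto
    also have "\<dots> = C" using BA C by simp
    finally show ?thesis using AC by simp
  qed
  have "transpose_mat B * transpose_mat A = 1\<^sub>m n"
    using AB transpose_mult[OF Ac Bc] by simp
  moreover have "transpose_mat B * ?S * B = transpose_mat B * (transpose_mat A * ?S * A) * B"
    by (simp add: Ao)
  moreover have "\<dots> = (transpose_mat B * transpose_mat A) * ?S * (A * B)"
    using Ac Bc by (simp add: assoc_mult_mat[of _ n n _ n _ n] mult_carrier_mat[of _ n n])
  ultimately have "transpose_mat B * ?S * B = ?S" using AB by simp
  then have "B \<in> carrier ?G" using Bc by (simp add: orthogonal_group_def)
  with BA show "\<exists>B \<in> carrier ?G. B \<otimes>\<^bsub>?G\<^esub> A = \<one>\<^bsub>?G\<^esub>"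
    by (auto simp: orthogonal_group_def)
qed

lemma group_special_orthogonal_group: "group (special_orthogonal_group n :: 'a::comm_ring_1 mat monoid)"
proof (rule groupI)
  let ?O = "orthogonal_group n :: 'a mat monoid" and ?G = "special_orthogonal_group n :: 'a mat monoid"
  interpret group ?O by (rule group_orthogonal_group)
  have O: "monoid.mult ?O = (*)" "one ?O = 1\<^sub>m n" "\<And>A. A \<in> carrier ?O \<Longrightarrow> A \<in> carrier_mat n n"
    by (simp_all add: orthogonal_group_def)
  have G: "monoid.mult ?G = (*)" "one ?G = 1\<^sub>m n" "\<And>A. A \<in> carrier ?G \<longleftrightarrow> A \<in> carrier ?O \<and> det A = 1"
    by (simp_all add: special_orthogonal_group_def)
  show "\<one>\<^bsub>?G\<^esub> \<in> carrier ?G" using one_closed O G by simp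
  fix A assume A: "A \<in> carrier ?G"
  show "\<one>\<^bsub>?G\<^esub> \<otimes>\<^bsub>?G\<^esub> A = A"
    using A G left_mult_one_mat[OF O(3)] by simp
  have "inv\<^bsub>?O\<^esub> A * A = 1\<^sub>m n" "inv\<^bsub>?O\<^esub> A \<in> carrier ?O" using l_inv[of A] A G O by auto
  moreover from this have "det (inv\<^bsub>?O\<^esub> A) = 1"
    using det_mult[of "inv\<^bsub>?O\<^esub> A" n A] A G O by simp
  ultimately show "\<exists>B \<in> carrier ?G. B \<otimes>\<^bsub>?G\<^esub> A = \<one>\<^bsub>?G\<^esub>" using G by auto
  fix B assume B: "B \<in> carrier ?G"
  show "A \<otimes>\<^bsub>?G\<^esub> B \<in> carrier ?G" using A B m_closed[of A B] O G det_mult[of A n B] by simp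
  fix C assume "C \<in> carrier ?G"
  then show "A \<otimes>\<^bsub>?G\<^esub> B \<otimes>\<^bsub>?G\<^esub> C = A \<otimes>\<^bsub>?G\<^esub> (B \<otimes>\<^bsub>?G\<^esub> C)"
    using A B m_assoc[of A B C] O G by simp
qed

text \<open>The right cosets of \<open>K\<close> are the fibres of \<open>r\<close>; compatibility
  with right multiplication takes the place of a group structure on the target.\<close>

lemma group_index_eq_card_image:
  assumes "group G"
    and K: "K = {x \<in> carrier G. r x = r \<one>\<^bsub>G\<^esub>}"
    and cong: "\<And>x y z. x \<in> carrier G \<Longrightarrow> y \<in> carrier G \<Longrightarrow> z \<in> carrier G \<Longrightarrow>
      r x = r y \<Longrightarrow> r (x \<otimes>\<^bsub>G\<^esub> z) = r (y \<otimes>\<^bsub>G\<^esub> z)"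
  shows "group_index G K = card (r ` carrier G)"
proof -
  interpret group G by fact
  have coset: "K #>\<^bsub>G\<^esub> a = {b \<in> carrier G. r b = r a}" if a: "a \<in> carrier G" for a
  proof (intro equalityI subsetI)
    fix b assume "b \<in> K #>\<^bsub>G\<^esub> a"
    then obtain k where k: "k \<in> K" "b = k \<otimes>\<^bsub>G\<^esub> a" by (auto simp: r_coset_def)
    then show "b \<in> {b \<in> carrier G. r b = r a}" using cong[of k "\<one>\<^bsub>G\<^esub>" a] a K by simp
  next
    fix b assume b: "b \<in> {b \<in> carrier G. r b = r a}"
    have "b \<otimes>\<^bsub>G\<^esub> inv\<^bsub>G\<^esub> a \<in> K" using cong[of b a "inv\<^bsub>G\<^esub> a"] a b K by simp
    moreover have "b = b \<otimes>\<^bsub>G\<^esub> inv\<^bsub>G\<^esub> a \<otimes>\<^bsub>G\<^esub> a" using a b by (simp add: m_assoc)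
    ultimately show "b \<in> K #>\<^bsub>G\<^esub> a" by (auto simp: r_coset_def)
  qed
  have "rcosets\<^bsub>G\<^esub> K = (\<lambda>a. K #>\<^bsub>G\<^esub> a) ` carrier G" by (auto simp: RCOSETS_def)
  moreover have "card ((\<lambda>a. K #>\<^bsub>G\<^esub> a) ` carrier G) = card (r ` carrier G)"
    by (rule card_image_eq_if_kernel_eq) (auto simp: coset)
  ultimately show ?thesis by (simp add: group_index_def)
qed

section \<open>Products and determinants of matrices modulo an ideal\<close>

lemma rep_cong_sum: "(\<And>i. i \<in> A \<Longrightarrow> rep d (f i) = rep d (g i)) \<Longrightarrow> rep d (sum f A) = rep d (sum g A)"
  by (induction A rule: infinite_finite_induct) (auto intro: rep_cong)

lemma rep_cong_prod: "(\<And>i. i \<in> A \<Longrightarrow> rep d (f i) = rep d (g i)) \<Longrightarrow> rep d (prod f A) = rep d (prod g A)"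
  by (induction A rule: infinite_finite_induct) (auto intro: rep_cong)

lemma map_mat_rep_eq_iff:
  assumes "A \<in> carrier_mat n n" "B \<in> carrier_mat n n"
  shows "map_mat (rep d) A = map_mat (rep d) B \<longleftrightarrow> (\<forall>i<n. \<forall>j<n. rep d (A $$ (i, j)) = rep d (B $$ (i, j)))"
  using assms by (auto simp: mat_eq_iff)

lemma map_mat_rep_cong_mult:
  assumes "A \<in> carrier_mat n n" "A' \<in> carrier_mat n n" "B \<in> carrier_mat n n" "B' \<in> carrier_mat n n"
    and "map_mat (rep d) A = map_mat (rep d) A'" "map_mat (rep d) B = map_mat (rep d) B'"
  shows "map_mat (rep d) (A * B) = map_mat (rep d) (A' * B')"
  using assms(5,6) unfolding map_mat_rep_eq_iff[OF assms(1,2)] map_mat_rep_eq_iff[OF assms(3,4)]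
    map_mat_rep_eq_iff[OF mult_carrier_mat[OF assms(1,3)] mult_carrier_mat[OF assms(2,4)]]
  by (auto simp: mult_mat_index[OF assms(1,3)] mult_mat_index[OF assms(2,4)] simp del: index_mult_mat(1)
      intro!: rep_cong_sum rep_cong_mult)

lemma rep_det_cong:
  assumes "A \<in> carrier_mat n n" "B \<in> carrier_mat n n" "map_mat (rep d) A = map_mat (rep d) B"
  shows "rep d (det A) = rep d (det B)"
  unfolding det_def'[OF assms(1)] det_def'[OF assms(2)]
proof (intro rep_cong_sum rep_cong_mult rep_cong_prod refl)
  fix p i assume p: "p \<in> {p. p permutes {0..<n}}" and i: "i \<in> {0..<n}"
  then have "p i < n" using permutes_in_image[of p "{0..<n}" i] by simp
  then show "rep d (A $$ (i, p i)) = rep d (B $$ (i, p i))"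
    using assms i by (simp add: map_mat_rep_eq_iff)
qed

text \<open>For even \<open>n\<close>, exchange the coordinates \<open>0\<close> and
  \<open>n div 2\<close>, which are partners of each other; for odd \<open>n\<close>, take minus the
  identity.\<close>

lemma exists_orthogonal_det_minus_one:
  assumes "n \<ge> 1"
  shows "\<exists>D \<in> carrier (orthogonal_group n). det D = (- 1 :: 'a::comm_ring_1)"
proof (cases "even n")
  case True
  define l where "l = n div 2"
  define s where "s = transpose 0 l"
  have l: "0 < l" "l < n" "n = 2 * l" using True assms by (auto simp: l_def)
  define D where "D = (swaprows_mat n 0 l :: 'a mat)"
  have D: "D = mat n n (\<lambda>(i, j). 1\<^sub>m n $$ (s i, j))"
    using l by (simp add: D_def s_def swap_rows_mat_eq_permute)
  have s_less: "s i < n" if "i < n" for i using that l by (auto simp: s_def transpose_def)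
  have ss: "s (s i) = i" for i by (simp add: s_def)
  have D_index: "D $$ (i, j) = (if i = s j then 1 else 0)" if "i < n" "j < n" for i j
    using that s_less ss by (auto simp: D)
  have comm: "s (partner l (s i)) = partner l i" for i
    using l by (auto simp: s_def transpose_def partner_def)
  have "(\<Sum>k<n. D $$ (k, i) * D $$ (partner (n div 2) k, j)) = (if j = partner (n div 2) i then 1 else 0)"
    if ij: "i < n" "j < n" for i j
  proof -
    have "(\<Sum>k<n. D $$ (k, i) * D $$ (partner (n div 2) k, j)) =
        (\<Sum>k<n. if k = s i then D $$ (partner (n div 2) k, j) else 0)"
      using ij by (intro sum.cong) (auto simp: D_index)
    also have "\<dots> = D $$ (partner (n div 2) (s i), j)" using ij s_less by simp
    also have "\<dots> = (if partner l (s i) = s j then 1 else 0)"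
      unfolding l_def[symmetric] using ij s_less partner_less[of "s i" n] D_index l_def by simp
    also have "partner l (s i) = s j \<longleftrightarrow> j = partner l i" using comm[of i] ss by metis
    finally show ?thesis by (simp add: l_def)
  qed
  then have "D \<in> carrier (orthogonal_group n)"
    by (subst orthogonal_iff) (auto simp: D)
  moreover have "det D = - 1" using l by (simp add: D_def det_swaprows_mat)
  ultimately show ?thesis by blast
next
  case False
  let ?D = "(- 1 :: 'a) \<cdot>\<^sub>m 1\<^sub>m n"
  have "(\<Sum>k<n. ?D $$ (k, i) * ?D $$ (partner (n div 2) k, j)) = (if j = partner (n div 2) i then 1 else 0)"
    if ij: "i < n" "j < n" for i j
  proof -
    have "(\<Sum>k<n. ?D $$ (k, i) * ?D $$ (partner (n div 2) k, j)) =
        (\<Sum>k<n. if k = i then - ?D $$ (partner (n div 2) k, j) else 0)"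
      using ij by (intro sum.cong) auto
    also have "\<dots> = - ?D $$ (partner (n div 2) i, j)" using ij by simp
    finally show ?thesis using ij partner_less by auto
  qed
  then have "?D \<in> carrier (orthogonal_group n)"
    by (subst orthogonal_iff) auto
  moreover have "det ((- 1 :: 'a) \<cdot>\<^sub>m 1\<^sub>m n) = - 1" using False by simp
  ultimately show ?thesis by blast
qed

context principal_local_level
begin

text \<open>Determinants are \<open>1\<close> or \<open>- 1\<close>, so the special group and its
  translate by \<open>D\<close> of determinant \<open>- 1\<close> cover everything. Their classes
  are disjoint because \<open>1\<close> and \<open>- 1\<close> are not congruent, and
  \<open>D\<close> acts injectively on classes.\<close>

lemma card_orthogonal_eq_twice_special:
  assumes "n \<ge> 1"
  shows "card (map_mat \<rho> ` carrier (orthogonal_group n)) =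
    2 * card (map_mat \<rho> ` carrier (special_orthogonal_group n))"
proof -
  let ?O = "orthogonal_group n :: 'a mat monoid" and ?SO = "special_orthogonal_group n :: 'a mat monoid"
  interpret group ?O by (rule group_orthogonal_group)
  have O: "monoid.mult ?O = (*)" "one ?O = 1\<^sub>m n" and c: "\<And>A. A \<in> carrier ?O \<Longrightarrow> A \<in> carrier_mat n n"
    by (simp_all add: orthogonal_group_def)
  have SO: "carrier ?SO = {A \<in> carrier ?O. det A = 1}"
    by (simp add: special_orthogonal_group_def)
  obtain D :: "'a mat" where D: "D \<in> carrier ?O" "det D = - 1"
    using exists_orthogonal_det_minus_one[OF assms] by blast
  have D_mult: "D * A \<in> carrier ?O" "det (D * A) = - det A" if "A \<in> carrier ?O" for A
    using m_closed[OF D(1) that] det_mult[OF c[OF D(1)] c[OF that]] D O by simp_all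
  obtain E where E: "E \<in> carrier ?O" "D * E = 1\<^sub>m n" "E * D = 1\<^sub>m n"
    using r_inv[OF D(1)] l_inv[OF D(1)] inv_closed[OF D(1)] O by metis
  have E_mult: "E * (D * A) = A" "D * (E * A) = A" if "A \<in> carrier ?O" for A
    using assoc_mult_mat[OF c[OF E(1)] c[OF D(1)] c[OF that]]
      assoc_mult_mat[OF c[OF D(1)] c[OF E(1)] c[OF that]] E c[OF that] by simp_all
  have cong: "map_mat \<rho> (D * A) = map_mat \<rho> (D * B) \<longleftrightarrow> map_mat \<rho> A = map_mat \<rho> B"
    if A: "A \<in> carrier ?O" and B: "B \<in> carrier ?O" for A B
  proof
    assume "map_mat \<rho> (D * A) = map_mat \<rho> (D * B)"
    then have "map_mat \<rho> (E * (D * A)) = map_mat \<rho> (E * (D * B))"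
      by (rule map_mat_rep_cong_mult[OF c[OF E(1)] c[OF E(1)] c[OF D_mult(1)[OF A]]
            c[OF D_mult(1)[OF B]] refl])
    then show "map_mat \<rho> A = map_mat \<rho> B" using E_mult A B by simp
  next
    assume "map_mat \<rho> A = map_mat \<rho> B"
    then show "map_mat \<rho> (D * A) = map_mat \<rho> (D * B)"
      by (rule map_mat_rep_cong_mult[OF c[OF D(1)] c[OF D(1)] c[OF A] c[OF B] refl])
  qed
  have "carrier ?O = carrier ?SO \<union> (*) D ` carrier ?SO"
  proof (intro equalityI subsetI)
    fix A assume A: "A \<in> carrier ?O"
    show "A \<in> carrier ?SO \<union> (*) D ` carrier ?SO"
    proof (cases "det A = 1")
      case False
      then have "det A = - 1" using square_eq_one[OF det_orthogonal_square[OF A]] by blast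
      moreover have "E * A \<in> carrier ?O" using m_closed[OF E(1) A] O by simp
      moreover from this have "det A = - det (E * A)" using D_mult(2)[of "E * A"] E_mult A by simp
      ultimately have "E * A \<in> carrier ?SO" using SO by simp
      then show ?thesis using E_mult(2)[OF A] by (metis UnI2 imageI)
    qed (use A SO in simp)
  qed (use SO D_mult in auto)
  then have "map_mat \<rho> ` carrier ?O = map_mat \<rho> ` carrier ?SO \<union> (\<lambda>A. map_mat \<rho> (D * A)) ` carrier ?SO"
    by (simp add: image_Un image_image)
  moreover have "map_mat \<rho> ` carrier ?SO \<inter> (\<lambda>A. map_mat \<rho> (D * A)) ` carrier ?SO = {}"
  proof -
    have "map_mat \<rho> A \<noteq> map_mat \<rho> (D * B)" if "A \<in> carrier ?SO" "B \<in> carrier ?SO" for A B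
    proof
      assume "map_mat \<rho> A = map_mat \<rho> (D * B)"
      then have "\<rho> (det A) = \<rho> (det (D * B))"
        using that SO D_mult c by (intro rep_det_cong[of _ n]) auto
      then show False using that SO D_mult rep_one_neq by simp
    qed
    then show ?thesis by blast
  qed
  moreover have "card ((\<lambda>A. map_mat \<rho> (D * A)) ` carrier ?SO) = card (map_mat \<rho> ` carrier ?SO)"
    using SO cong by (intro card_image_eq_if_kernel_eq) simp
  moreover have "finite (map_mat \<rho> ` carrier ?O)" by (rule finite_orthogonal_classes)
  ultimately show ?thesis by (simp add: card_Un_disjoint)
qed

end

section \<open>The index formulas\<close>

context principal_local
begin

lemma q_pos: "q > 0"
proof -
  have "card (range (rep \<pi>)) \<noteq> 0" using finite_residues by simp
  then show ?thesis using card_residues by simp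
qed

end

context principal_local_level
begin

lemma q_power_m: "q ^ m = q * q ^ (m - 1)"
  using m_pos by (cases m) auto

lemma real_num_prim_Suc_Suc:
  "real (num_prim (Suc (Suc n))) =
    (real (q ^ m) - real (q ^ (m - 1))) * (real (q ^ m) ^ n + real (q ^ (m - 1)) ^ n) +
     real (q ^ m) * real (q ^ (m - 1)) * real (num_prim n)"
proof -
  have "q ^ (m - 1) \<le> q ^ m" using q_pos q_power_m by simp
  then show ?thesis by (simp add: of_nat_diff)
qed

lemma num_prim_odd:
  "real (num_prim (2 * l + 1)) = real (q ^ m) ^ (2 * l) - real (q ^ (m - 1)) ^ (2 * l)"
proof (induction l)
  case (Suc l)
  then have "real (num_prim (Suc (2 * l))) = real (q ^ m) ^ (2 * l) - real (q ^ (m - 1)) ^ (2 * l)"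
    by simp
  moreover have "2 * Suc l + 1 = Suc (Suc (Suc (2 * l)))" by simp
  ultimately show ?case
    by (simp only: real_num_prim_Suc_Suc) (simp add: algebra_simps)
qed simp

lemma num_prim_even:
  "real (num_prim (2 * Suc l)) =
    (real (q ^ m) ^ Suc l - real (q ^ (m - 1)) ^ Suc l) * (real (q ^ m) ^ l + real (q ^ (m - 1)) ^ l)"
proof (induction l)
  case 0
  have "2 * Suc 0 = Suc (Suc 0)" by simp
  then show ?case by (simp only: real_num_prim_Suc_Suc) simp
next
  case (Suc l)
  have eq: "2 * Suc (Suc l) = Suc (Suc (2 * Suc l))" by simp
  have power: "x ^ (2 * Suc l) = x ^ Suc l * x ^ Suc l" for x :: real
    by (simp only: mult_2 power_add)
  show ?case
    unfolding eq real_num_prim_Suc_Suc Suc.IH power by (simp add: algebra_simps)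
qed

text \<open>Splits off a power of \<open>q ^ m\<close> and leaves a factor free of \<open>m\<close>,
  since \<open>q ^ (m - 1)\<close> is \<open>q ^ m\<close> divided by \<open>q\<close>.\<close>

lemma level_power_diff:
  "real (q ^ m) ^ k - real (q ^ (m - 1)) ^ k = real (q ^ m) ^ k * (1 - 1 / real q ^ k)"
  "real (q ^ m) ^ k + real (q ^ (m - 1)) ^ k = real (q ^ m) ^ k * (1 + 1 / real q ^ k)"
proof -
  have "real (q ^ m) ^ k * (1 / real q ^ k) = real (q ^ (m - 1)) ^ k"
    using q_pos by (simp add: q_power_m power_mult_distrib)
  then show "real (q ^ m) ^ k - real (q ^ (m - 1)) ^ k = real (q ^ m) ^ k * (1 - 1 / real q ^ k)"
    "real (q ^ m) ^ k + real (q ^ (m - 1)) ^ k = real (q ^ m) ^ k * (1 + 1 / real q ^ k)"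
    by (simp_all add: algebra_simps)
qed

text \<open>The leading \<open>2\<close> counts the frames of length 1. A step adds
  \<open>2 * Suc l\<close> to the exponent of \<open>q ^ m\<close> for the first vector and
  \<open>2 * l + 1\<close> for the second, and the first vector also brings the new factor of the
  product.\<close>

lemma card_frame_classes_odd:
  "real (card (frame_classes (2 * l + 1))) =
    2 * (real (q ^ m) ^ (2 * l\<^sup>2 + l) * (\<Prod>i = 1..l. 1 - 1 / real q ^ (2 * i)))"
proof (induction l)
  case 0
  then show ?case by (simp add: card_frame_classes_1)
next
  case (Suc l)
  let ?N = "real (q ^ m)" and ?p = "\<lambda>l. \<Prod>i = 1..l. 1 - 1 / real q ^ (2 * i)"
  have eq: "2 * Suc l + 1 = Suc (Suc (2 * l + 1))" by simp
  have "real (card (frame_classes (2 * Suc l + 1))) =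
      real (num_prim (2 * Suc l + 1)) * ?N ^ (2 * l + 1) * real (card (frame_classes (2 * l + 1)))"
    unfolding eq card_frame_classes_Suc_Suc by (simp del: num_prim.simps)
  also have "real (num_prim (2 * Suc l + 1)) = ?N ^ (2 * Suc l) * (1 - 1 / real q ^ (2 * Suc l))"
    unfolding num_prim_odd level_power_diff ..
  also have "?N ^ (2 * Suc l) * (1 - 1 / real q ^ (2 * Suc l)) * ?N ^ (2 * l + 1) *
      real (card (frame_classes (2 * l + 1))) =
      2 * (?N ^ (2 * Suc l + (2 * l + 1) + (2 * l\<^sup>2 + l)) * (?p l * (1 - 1 / real q ^ (2 * Suc l))))"
    unfolding Suc.IH power_add by (simp only: ac_simps)
  also have "2 * Suc l + (2 * l + 1) + (2 * l\<^sup>2 + l) = 2 * (Suc l)\<^sup>2 + Suc l"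
    by (simp add: power2_eq_square)
  also have "?p l * (1 - 1 / real q ^ (2 * Suc l)) = ?p (Suc l)" by simp
  finally show ?case .
qed

text \<open>The exponent is \<open>2 * (Suc l)\<^sup>2 - Suc l\<close>. In a step the old factor
  \<open>1 - 1 / real q ^ Suc l\<close> meets \<open>1 + 1 / real q ^ Suc l\<close> from
  \<open>num_prim_even\<close>; together they form the next factor of the product.\<close>

lemma card_frame_classes_even:
  "real (card (frame_classes (2 * Suc l))) =
    2 * (real (q ^ m) ^ (2 * l\<^sup>2 + 3 * l + 1) * (1 - 1 / real q ^ Suc l) *
      (\<Prod>i = 1..l. 1 - 1 / real q ^ (2 * i)))"
proof (induction l)
  case 0
  have "2 * Suc 0 = Suc (Suc 0)" by simp
  then have "real (card (frame_classes (2 * Suc 0))) = real (num_prim (2 * Suc 0))"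
    by (simp only: card_frame_classes_Suc_Suc card_frame_classes_0) simp
  also have "\<dots> = 2 * (real (q ^ m) * (1 - 1 / real q))"
    unfolding num_prim_even using level_power_diff(1)[of 1] by simp
  finally show ?case by simp
next
  case (Suc l)
  let ?N = "real (q ^ m)" and ?p = "\<lambda>l. \<Prod>i = 1..l. 1 - 1 / real q ^ (2 * i)"
  have eq: "2 * Suc (Suc l) = Suc (Suc (2 * Suc l))" by simp
  have "real (card (frame_classes (2 * Suc (Suc l)))) =
      real (num_prim (2 * Suc (Suc l))) * ?N ^ (2 * Suc l) * real (card (frame_classes (2 * Suc l)))"
    unfolding eq card_frame_classes_Suc_Suc by (simp del: num_prim.simps)
  also have "real (num_prim (2 * Suc (Suc l))) =
      ?N ^ Suc (Suc l) * (1 - 1 / real q ^ Suc (Suc l)) * (?N ^ Suc l * (1 + 1 / real q ^ Suc l))"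
    unfolding num_prim_even level_power_diff ..
  also have "?N ^ Suc (Suc l) * (1 - 1 / real q ^ Suc (Suc l)) * (?N ^ Suc l * (1 + 1 / real q ^ Suc l)) *
      ?N ^ (2 * Suc l) * real (card (frame_classes (2 * Suc l))) =
      2 * (?N ^ (Suc (Suc l) + Suc l + 2 * Suc l + (2 * l\<^sup>2 + 3 * l + 1)) *
        (1 - 1 / real q ^ Suc (Suc l)) *
        (?p l * ((1 + 1 / real q ^ Suc l) * (1 - 1 / real q ^ Suc l))))"
    unfolding Suc.IH power_add by (simp only: ac_simps)
  also have "Suc (Suc l) + Suc l + 2 * Suc l + (2 * l\<^sup>2 + 3 * l + 1) = 2 * (Suc l)\<^sup>2 + 3 * Suc l + 1"
    by (simp add: power2_eq_square)
  also have "(1 + 1 / real q ^ Suc l) * (1 - 1 / real q ^ Suc l) = 1 - 1 / real q ^ (2 * Suc l)"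
  proof -
    have "real q ^ (2 * Suc l) = real q ^ Suc l * real q ^ Suc l"
      by (simp only: mult_2 power_add)
    then show ?thesis by (simp add: algebra_simps del: power_Suc)
  qed
  also have "?p l * (1 - 1 / real q ^ (2 * Suc l)) = ?p (Suc l)" by simp
  finally show ?case .
qed

end

section \<open>Translation from ideals and cosets\<close>

lemma coset_eq_iff:
  fixes d :: "'a::comm_ring_1"
  shows "{x. d dvd x} +>\<^bsub>class_ring\<^esub> a = {x. d dvd x} +>\<^bsub>class_ring\<^esub> b \<longleftrightarrow> rep d a = rep d b"
proof -
  have coset: "{x. d dvd x} +>\<^bsub>class_ring\<^esub> c = {x. rep d x = rep d c}" for c
  proof -
    have "{x. d dvd x} +>\<^bsub>class_ring\<^esub> c = {i + c | i. d dvd i}" by (auto simp: a_r_coset_def r_coset_def)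
    also have "\<dots> = {x. d dvd x - c}" by (auto intro: exI[of _ "_ - c"])
    finally show ?thesis by (simp add: rep_eq_iff)
  qed
  show ?thesis unfolding coset by auto
qed

lemma reduce_mat_eq_iff:
  "reduce_mat {x. d dvd x} A = reduce_mat {x. d dvd x} B \<longleftrightarrow> map_mat (rep d) A = map_mat (rep d) B"
  by (simp add: reduce_mat_def mat_eq_iff coset_eq_iff cong: conj_cong)

lemma quot_one_mat_eq: "quot_one_mat {x. d dvd x} n = reduce_mat {x. d dvd x} (1\<^sub>m n)"
proof -
  have "{x. d dvd x} +>\<^bsub>class_ring\<^esub> 0 = {x. d dvd x}" by (auto simp: a_r_coset_def r_coset_def)
  then show ?thesis
    by (intro eq_matI) (auto simp: quot_one_mat_def reduce_mat_def FactRing_def)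
qed

lemma card_Quot:
  "card (carrier (class_ring Quot {x. d dvd x})) = card (range (rep d))"
  "finite (carrier (class_ring Quot {x. d dvd x})) \<longleftrightarrow> finite (range (rep d))"
proof -
  have "carrier (class_ring Quot {x. d dvd x}) = range (\<lambda>a. {x. d dvd x} +>\<^bsub>class_ring\<^esub> a)"
    by (auto simp: FactRing_def A_RCOSETS_def RCOSETS_def a_r_coset_def)
  then show "card (carrier (class_ring Quot {x. d dvd x})) = card (range (rep d))"
    "finite (carrier (class_ring Quot {x. d dvd x})) \<longleftrightarrow> finite (range (rep d))"
    using card_image_eq_if_kernel_eq[of UNIV _ "rep d", OF coset_eq_iff] by auto
qed

lemma Idl_singleton: "Idl\<^bsub>class_ring\<^esub> {d} = {x :: 'a::comm_ring_1. d dvd x}"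
proof -
  have "Idl\<^bsub>class_ring\<^esub> {d} = PIdl\<^bsub>class_ring\<^esub> d"
    using cring.cgenideal_eq_genideal[OF class_cring.is_cring, of d] by simp
  also have "\<dots> = {x. d dvd x}" by (auto simp: cgenideal_def dvd_def mult.commute)
  finally show ?thesis .
qed

text \<open>The power \<open>0\<close> is the whole ring. In a step, \<open>d ^ k * (d * z)\<close>
  is itself one of the generating products, and all sums of such products are multiples of
  \<open>d ^ Suc k\<close>.\<close>

lemma ideal_power_eq:
  "{x. d dvd x} [^]\<^bsub>ideals_set class_ring\<^esub> k = {x :: 'a::comm_ring_1. d ^ k dvd x}"
proof (induction k)
  case 0
  then show ?case by (simp add: nat_pow_def ideals_set_def)
next
  case (Suc k)
  have "ideal_prod class_ring {x. d ^ k dvd x} {x. d dvd x} = {x. d ^ Suc k dvd x}"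
  proof (intro equalityI subsetI)
    fix x assume "x \<in> ideal_prod class_ring {x. d ^ k dvd x} {x. d dvd x}"
    then show "x \<in> {x. d ^ Suc k dvd x}"
      by (induction rule: ideal_prod.induct) (auto simp: power_commutes[symmetric] intro: mult_dvd_mono simp del: power_Suc simp: power_Suc2)
  next
    fix x assume "x \<in> {x. d ^ Suc k dvd x}"
    then obtain z where "x = d ^ k * (d * z)" by (auto simp: dvd_def ac_simps)
    then show "x \<in> ideal_prod class_ring {x. d ^ k dvd x} {x. d dvd x}"
      using ideal_prod.prod[of "d ^ k" "{x. d ^ k dvd x}" "d * z" "{x. d dvd x}" class_ring] by simp
  qed
  with Suc show ?case by (simp add: nat_pow_def ideals_set_def)
qed

text \<open>By Zorn's lemma some ideal is maximal among those that contain the non-unit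
  \<open>x\<close> and miss \<open>1\<close>; it is a maximal ideal, hence equals \<open>P\<close>
  by uniqueness.\<close>

lemma dvd_one_if_local:
  fixes x :: "'a::comm_ring_1"
  assumes local: "local_ring_with (class_ring :: 'a ring) P" and x: "x \<notin> P"
  shows "x dvd 1"
proof (rule ccontr)
  assume not_unit: "\<not> x dvd 1"
  let ?R = "class_ring :: 'a ring"
  let ?A = "{I. ideal I ?R \<and> x \<in> I \<and> 1 \<notin> I}"
  have "\<exists>M \<in> ?A. \<forall>I \<in> ?A. M \<subseteq> I \<longrightarrow> I = M"
  proof (rule subset_Zorn_nonempty)
    have "ideal (Idl\<^bsub>?R\<^esub> {x}) ?R" using ring.genideal_ideal[OF class_ring.ring_axioms, of "{x}"] by simp
    then have "{y. x dvd y} \<in> ?A" using not_unit by (simp add: Idl_singleton)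
    then show "?A \<noteq> {}" by blast
    fix C assume C: "C \<noteq> {}" "subset.chain ?A C"
    then have "subset.chain {I. ideal I ?R} C" by (auto simp: subset_chain_def)
    then have "ideal (\<Union>C) ?R" using ring.chain_Union_is_ideal[OF class_ring.ring_axioms, of C] C(1) by simp
    then show "\<Union>C \<in> ?A" using C by (auto simp: subset_chain_def)
  qed
  then obtain M where M: "ideal M ?R" "x \<in> M" "1 \<notin> M"
    and max: "\<And>I. ideal I ?R \<Longrightarrow> x \<in> I \<Longrightarrow> 1 \<notin> I \<Longrightarrow> M \<subseteq> I \<Longrightarrow> I = M"
    by blast
  have "maximalideal M ?R"
  proof (rule maximalidealI[OF M(1)])
    show "carrier ?R \<noteq> M" using M(3) by auto
    fix J assume J: "ideal J ?R" "M \<subseteq> J" "J \<subseteq> carrier ?R"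
    show "J = M \<or> J = carrier ?R"
    proof (cases "1 \<in> J")
      case True
      then show ?thesis using ideal.one_imp_carrier[OF J(1)] by simp
    next
      case False
      then show ?thesis using max[OF J(1)] J(2) M(2) by blast
    qed
  qed
  then have "M = P" using local by (simp add: local_ring_with_def)
  with M(2) x show False by simp
qed

context principal_local_level
begin

section \<open>Indices of the congruence kernels\<close>

lemma group_index_orthogonal:
  "group_index (orthogonal_group n) (orthogonal_kernel n {x. \<pi> ^ m dvd x}) =
    card (map_mat \<rho> ` carrier (orthogonal_group n))"
proof (rule group_index_eq_card_image[OF group_orthogonal_group])
  show "orthogonal_kernel n {x. \<pi> ^ m dvd x} = {M \<in> carrier (orthogonal_group n).
      map_mat \<rho> M = map_mat \<rho> \<one>\<^bsub>orthogonal_group n\<^esub>}"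
    by (simp add: orthogonal_kernel_def quot_one_mat_eq reduce_mat_eq_iff) (simp add: orthogonal_group_def)
qed (auto simp: orthogonal_group_def intro!: map_mat_rep_cong_mult[of _ n])

lemma group_index_special_orthogonal:
  "group_index (special_orthogonal_group n) (special_orthogonal_kernel n {x. \<pi> ^ m dvd x}) =
    card (map_mat \<rho> ` carrier (special_orthogonal_group n))"
proof (rule group_index_eq_card_image[OF group_special_orthogonal_group])
  show "special_orthogonal_kernel n {x. \<pi> ^ m dvd x} = {M \<in> carrier (special_orthogonal_group n).
      map_mat \<rho> M = map_mat \<rho> \<one>\<^bsub>special_orthogonal_group n\<^esub>}"
    by (simp add: special_orthogonal_kernel_def quot_one_mat_eq reduce_mat_eq_iff)
      (simp add: special_orthogonal_group_def)
qed (auto simp: special_orthogonal_group_def orthogonal_group_def intro!: map_mat_rep_cong_mult[of _ n])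

end

theorem theorem4:
  fixes P :: "'a::comm_ring_1 set" and \<pi> :: 'a and q l m :: nat
  assumes "local_ring_with (class_ring :: 'a ring) P"
    and "P = Idl\<^bsub>class_ring\<^esub> {\<pi>}"
    and "\<forall>x. \<pi> * x = 0 \<longrightarrow> x = 0"
    and "finite (carrier (class_ring Quot P))"
    and "ring_characteristic (class_ring Quot P) \<noteq> 2"
    and "q = card (carrier (class_ring Quot P))"
    and "m \<ge> 1"
  shows
    "(let Pm = P [^]\<^bsub>ideals_set class_ring\<^esub> m;
          iO = (\<lambda>n. group_index (orthogonal_group n) (orthogonal_kernel n Pm));
          iSO = (\<lambda>n. group_index (special_orthogonal_group n) (special_orthogonal_kernel n Pm))
      in iO (2 * l + 1) = 2 * iSO (2 * l + 1)
       \<and> real (iSO (2 * l + 1)) =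
           real q ^ ((2 * l^2 + l) * m) * (\<Prod>i = 1..l. 1 - 1 / real q ^ (2 * i))
       \<and> (l \<ge> 1 \<longrightarrow>
             iO (2 * l) = 2 * iSO (2 * l)
           \<and> real (iSO (2 * l)) =
               real q ^ ((2 * l^2 - l) * m) * (1 - 1 / real q ^ l)
                 * (\<Prod>i = 1..l - 1. 1 - 1 / real q ^ (2 * i))))"
proof -
  let ?R = "class_ring :: 'a ring"
  have P: "P = {x. \<pi> dvd x}" using assms(2) by (simp add: Idl_singleton)
  have max: "maximalideal P ?R" using assms(1) by (simp add: local_ring_with_def)
  then have ideal: "ideal P ?R" by (rule maximalideal.axioms(1))
  have unit: "x dvd 1" if "\<not> \<pi> dvd x" for x
    using dvd_one_if_local[OF assms(1), of x] that P by simp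
  have not_one: "\<not> \<pi> dvd 1"
    using ideal.one_imp_carrier[OF ideal] maximalideal.I_notcarr[OF max] P by auto
  \<comment> \<open>Here the residue characteristic enters: if \<open>\<pi>\<close> divided
    \<open>2\<close>, exactly the even multiples of the unit element would vanish in the quotient,
    whose characteristic would then be \<open>2\<close>.\<close>
  have "\<not> \<pi> dvd 2"
  proof
    assume two: "\<pi> dvd 2"
    let ?Q = "?R Quot P"
    interpret Q: ring ?Q using ideal by (rule ideal.quotient_is_ring)
    note hom = ideal.rcos_ring_hom[OF ideal]
    have zero: "\<zero>\<^bsub>?Q\<^esub> = P +>\<^bsub>?R\<^esub> 0"
      using ring_hom_zero[OF hom class_ring.ring_axioms Q.ring_axioms] by simp
    have multiple: "[n] \<cdot>\<^bsub>?Q\<^esub> \<one>\<^bsub>?Q\<^esub> = P +>\<^bsub>?R\<^esub> of_nat n" for n :: nat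
    proof (induction n)
      case 0
      show ?case using zero by simp
    next
      case (Suc n)
      have "P +>\<^bsub>?R\<^esub> (of_nat n + 1) = (P +>\<^bsub>?R\<^esub> of_nat n) \<oplus>\<^bsub>?Q\<^esub> (P +>\<^bsub>?R\<^esub> 1)"
        using ring_hom_add[OF hom, of "of_nat n" 1] by simp
      with Suc ring_hom_one[OF hom] show ?case by (simp add: add.commute)
    qed
    have mem: "[n] \<cdot>\<^bsub>?Q\<^esub> \<one>\<^bsub>?Q\<^esub> = \<zero>\<^bsub>?Q\<^esub> \<longleftrightarrow> \<pi> dvd of_nat n" for n :: nat
      unfolding multiple zero unfolding P coset_eq_iff rep_eq_iff by simp
    have "2 dvd n" if "\<pi> dvd of_nat n" for n :: nat
    proof (rule ccontr)
      assume "\<not> 2 dvd n"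
      then obtain k where "n = 2 * k + 1" by (rule oddE)
      then have "\<pi> dvd 2 * of_nat k + 1" using that by (simp add: add.commute)
      then show False using not_one dvd_add_right_iff[OF dvd_mult2[OF two]] by blast
    qed
    then have "2 dvd ring_characteristic ?Q"
      unfolding ring_characteristic_def mem by (intro Gcd_greatest) simp
    moreover have "ring_characteristic ?Q dvd 2"
      unfolding ring_characteristic_def mem using two by (intro Gcd_dvd) simp
    ultimately have "ring_characteristic ?Q = 2" by (intro dvd_antisym)
    then show False using assms(5) by simp
  qed
  then have "2 dvd (1 :: 'a)" by (rule unit)
  then obtain h :: 'a where "1 = 2 * h" by (rule dvdE)
  then have half: "2 * h = 1" by (rule sym)
  interpret principal_local_level \<pi> h q m
    using unit not_one assms(3,4,6,7) half card_Quot[of \<pi>] P by unfold_locales auto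
  have power: "P [^]\<^bsub>ideals_set ?R\<^esub> m = {x. \<pi> ^ m dvd x}"
    unfolding P by (rule ideal_power_eq)
  define iO where "iO n = card (map_mat \<rho> ` carrier (orthogonal_group n :: 'a mat monoid))" for n
  define iSO where "iSO n = card (map_mat \<rho> ` carrier (special_orthogonal_group n :: 'a mat monoid))" for n
  have twice: "iO n = 2 * iSO n" if "n \<ge> 1" for n
    unfolding iO_def iSO_def using that by (rule card_orthogonal_eq_twice_special)
  have N: "real (q ^ m) ^ k = real q ^ (k * m)" for k
    by (simp add: power_mult[symmetric] mult.commute)
  have odd: "real (iSO (2 * l + 1)) =
      real q ^ ((2 * l^2 + l) * m) * (\<Prod>i = 1..l. 1 - 1 / real q ^ (2 * i))"
    using card_frame_classes_odd[of l] twice[of "2 * l + 1"] card_orthogonal_classes[of "2 * l + 1"]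
    unfolding N iO_def by simp
  have even: "real (iSO (2 * l)) = real q ^ ((2 * l^2 - l) * m) * (1 - 1 / real q ^ l)
      * (\<Prod>i = 1..l - 1. 1 - 1 / real q ^ (2 * i))" if "l \<ge> 1"
  proof -
    \<comment> \<open>\<open>l = Suc k\<close> matches the index of the even count and resolves the
      truncated subtractions in \<open>2 * l^2 - l\<close> and \<open>l - 1\<close>.\<close>
    obtain k where k: "l = Suc k" using \<open>l \<ge> 1\<close> by (cases l) auto
    have "2 * l^2 - l = 2 * k^2 + 3 * k + 1" unfolding k by (simp add: power2_eq_square)
    then show ?thesis
      using card_frame_classes_even[of k] twice[of "2 * l"] card_orthogonal_classes[of "2 * l"]
      unfolding N iO_def k by simp
  qed
  show ?thesis
    unfolding Let_def power group_index_orthogonal group_index_special_orthogonal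
      iO_def[symmetric] iSO_def[symmetric]
    using twice odd even by simp
qed

end
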